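(* Let $k$ be a field with $\operatorname{char} k \neq 2$ and let $k(X,Y)$ denote the rational function field in two variables over $k$. Define $\nu$ on $k[X,Y]$ by $$\nu\Big(\sum_{a,b \in \mathbb{N}} c_{a,b} X^a Y^b\Big) = \min\{(a,b) \mid c_{a,b} \neq 0\} \in \mathbb{Z}\oplus\mathbb{Z},$$ where $\mathbb{Z}\oplus\mathbb{Z}$ carries the lexicographic order, and extend $\nu$ to a valuation on $k(X,Y)$ by $\nu(f/g) := \nu(f)-\nu(g)$ for $f,g\in k[X,Y]$, $g \neq 0$. Let $K = (k(X,Y),\nu)^h$ be the henselization of $k(X,Y)$ with respect to $\nu$, and denote again by $\nu$ its valuation and the unique extension of it to algebraic extensions of $K$. Let $L_1 = K(\sqrt{X})$, $L_2 = K(\sqrt{Y})$, and let $L = L_1\cdot L_2$ be the compositum. Then $(L/L_2,\nu)$ is ramified.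
   Context: Here $\mathbb{N}$ includes $0$, sums are finite with $c_{a,b}\in k$, and $\nu(0)=\infty$. All algebraic extensions are taken inside a fixed algebraic closure of $K$. For a valued field $(F,\nu)$ (additive notation, arbitrary ordered abelian value group), $\nu F$ is the value group and $F\nu$ the residue field. A valued field is henselian if its valuation extends uniquely to its algebraic closure (equivalently, Hensel's Lemma holds). The residue characteristic is $p=\operatorname{char} F\nu$ if this is positive, and $p=1$ otherwise. A finite extension $(F'/F,\nu)$ of henselian valued fields is defectless if $[F':F]=[\nu F':\nu F]\,[F'\nu:F\nu]$. An algebraic extension $(F'/F,\nu)$ of henselian valued fields is tame if for every finite subextension $F''/F$: (i) $p$ does not divide $[\nu F'':\nu F]$ (no condition when $\operatorname{char} F\nu=0$); (ii) $F''\nu/F\nu$ is separable; (iii) $(F''/F,\nu)$ is defectless. An extension $(F'/F,\nu)$ of henselian valued fields is unramified if it is tame and $\nu F'=\nu F$; it is ramified if it is not unramified. *)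

theory Defs
  imports
    "HOL-Algebra.Algebraic_Closure_Type"
    "HOL-Algebra.Coset"
    "HOL-Algebra.QuotRing"
    "HOL-Algebra.Generated_Fields"
    "HOL-Algebra.Finite_Extensions"
    "HOL-Library.Extended"
    "HOL-Library.Product_Plus"
    "HOL-Library.Product_Lexorder"
begin

section \<open>Ordered abelian groups\<close>

instance prod :: (linordered_ab_group_add, linordered_ab_group_add) linordered_ab_group_add
  by standard (auto simp: less_eq_prod_def)

class divisible_linordered_ab_group_add = linordered_ab_group_add +
  assumes divisible: "0 < n \<Longrightarrow> \<exists>y. (\<Sum>i<(n::nat). y) = x"

instance rat :: divisible_linordered_ab_group_add
proof
  fix n :: nat and x :: rat
  assume "0 < n"
  then show "\<exists>y. (\<Sum>i<n. y) = x"
    by (intro exI[of _ "x / of_nat n"]) simp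
qed

instance prod :: (divisible_linordered_ab_group_add, divisible_linordered_ab_group_add)
  divisible_linordered_ab_group_add
proof
  fix n :: nat and x :: "'a \<times> 'b"
  assume n: "0 < n"
  obtain a where a: "(\<Sum>i<n. a) = fst x" using divisible[OF n] by blast
  obtain b where b: "(\<Sum>i<n. b) = snd x" using divisible[OF n] by blast
  have "(\<Sum>i<n. (a, b)) = x"
    by (rule prod_eqI) (simp_all only: fst_sum snd_sum fst_conv snd_conv a b)
  then show "\<exists>y. (\<Sum>i<n. y) = x" ..
qed


section \<open>Valued fields\<close>

text \<open>
  All fields are subfields of one algebraically closed field, given as a type and viewed as a
  HOL-Algebra ring through \<^const>\<open>ring_of_type_algebra\<close>.  Valuations are written additively,
  with values in \<open>'g \<union> {\<infinity>}\<close>; the constructor \<^const>\<open>Minf\<close> of \<open>'g extended\<close> never occurs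
  as a value.
\<close>

abbreviation ambient :: "'a::field ring"  (\<open>\<Omega>\<close>)
  where "\<Omega> \<equiv> ring_of_type_algebra"

definition valuation_on ::
    "'a::field set \<Rightarrow> ('a \<Rightarrow> 'g::linordered_ab_group_add extended) \<Rightarrow> bool" where
  "valuation_on F v \<longleftrightarrow>
     (\<forall>x\<in>F. v x \<noteq> Minf) \<and>
     (\<forall>x\<in>F. v x = Pinf \<longleftrightarrow> x = 0) \<and>
     (\<forall>x\<in>F. \<forall>y\<in>F. v (x * y) = v x + v y) \<and>
     (\<forall>x\<in>F. \<forall>y\<in>F. min (v x) (v y) \<le> v (x + y))"

definition value_group :: "('a::field \<Rightarrow> 'g::linordered_ab_group_add extended) \<Rightarrow> 'a set \<Rightarrow> 'g set" where
  "value_group v F = {g. \<exists>x\<in>F. v x = Fin g}"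

definition value_index ::
    "('a::field \<Rightarrow> 'g::linordered_ab_group_add extended) \<Rightarrow> 'a set \<Rightarrow> 'a set \<Rightarrow> nat" where
  "value_index v F F' =
     card (rcosets\<^bsub>\<lparr>carrier = value_group v F', monoid.mult = (+), one = 0\<rparr>\<^esub> (value_group v F))"

definition valuation_ring ::
    "('a::field \<Rightarrow> 'g::linordered_ab_group_add extended) \<Rightarrow> 'a ring" where
  "valuation_ring v = \<Omega>\<lparr>carrier := {x. 0 \<le> v x}\<rparr>"

definition ambient_residue_field ::
    "('a::field \<Rightarrow> 'g::linordered_ab_group_add extended) \<Rightarrow> 'a set ring" where
  "ambient_residue_field v = valuation_ring v Quot {x. 0 < v x}"

text \<open>
  The residue field of a subfield \<open>F\<close> is taken inside the residue field of the ambient field, via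
  the canonical embedding; so residue fields of extensions become honest extensions of sets.
\<close>

definition residue_set ::
    "('a::field \<Rightarrow> 'g::linordered_ab_group_add extended) \<Rightarrow> 'a set \<Rightarrow> 'a set set" where
  "residue_set v F = {{x. 0 < v x} +>\<^bsub>valuation_ring v\<^esub> x | x. x \<in> F \<and> 0 \<le> v x}"

definition ring_char :: "('b, 'c) ring_scheme \<Rightarrow> nat" where
  "ring_char R = (if \<exists>n>0. add_pow R (n::nat) \<one>\<^bsub>R\<^esub> = \<zero>\<^bsub>R\<^esub>
                  then LEAST n. 0 < n \<and> add_pow R n \<one>\<^bsub>R\<^esub> = \<zero>\<^bsub>R\<^esub> else 0)"

definition residue_char ::
    "('a::field \<Rightarrow> 'g::linordered_ab_group_add extended) \<Rightarrow> 'a set \<Rightarrow> nat" where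
  "residue_char v F = ring_char (ambient_residue_field v\<lparr>carrier := residue_set v F\<rparr>)"

text \<open>
  \<open>R\<close> is meant to be algebraically closed (here: the residue field of an algebraically closed
  valued field), so that the second conjunct says that minimal polynomials over \<open>k\<close> have no
  multiple roots in an algebraic closure.
\<close>

definition separable_extension :: "('b, 'c) ring_scheme \<Rightarrow> 'b set \<Rightarrow> 'b set \<Rightarrow> bool" where
  "separable_extension R k l \<longleftrightarrow>
     (\<forall>x\<in>l. \<not> ring.transcendental R k x \<and>
             (\<forall>y\<in>carrier R. ring.alg_mult R (ring.Irr R k x) y \<le> 1))"


section \<open>Henselian fields and henselizations\<close>

definition alg_closure_in_ambient :: "'a::alg_closed_field set \<Rightarrow> 'a set" where
  "alg_closure_in_ambient F = {x. \<not> ring.transcendental \<Omega> F x}"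

text \<open>
  Every extension of \<open>v\<close> to the algebraic closure of \<open>F\<close> has its value group inside the divisible
  hull of the value group of \<open>F\<close>, which embeds uniquely over the latter into the divisible ordered
  group \<open>'g\<close>.  Hence extensions up to equivalence, with arbitrary value groups, are the same as
  extensions with values in \<open>'g\<close> up to equality.
\<close>

definition henselian ::
    "'a::alg_closed_field set \<Rightarrow> ('a \<Rightarrow> 'g::divisible_linordered_ab_group_add extended) \<Rightarrow> bool" where
  "henselian F v \<longleftrightarrow>
     subfield F \<Omega> \<and> valuation_on F v \<and>
     (\<exists>w. valuation_on (alg_closure_in_ambient F) w \<and> (\<forall>x\<in>F. w x = v x) \<and>
          (\<forall>w'. valuation_on (alg_closure_in_ambient F) w' \<and> (\<forall>x\<in>F. w' x = v x)
                \<longrightarrow> (\<forall>x\<in>alg_closure_in_ambient F. w' x = w x)))"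

text \<open>
  The henselization \<open>(K, v)\<close> of \<open>(F, v)\<close> by its universal property: it is a henselian extension,
  and embeds uniquely over \<open>F\<close>, as a valued field, into every henselian extension \<open>(E, u)\<close>.  It
  suffices to test inside the ambient field if that contains an algebraic closure of \<open>F\<close>, as the
  relative algebraic closure of \<open>F\<close> in a henselian extension is henselian.
\<close>

definition is_henselization ::
    "'a::alg_closed_field set \<Rightarrow> ('a \<Rightarrow> 'g::divisible_linordered_ab_group_add extended) \<Rightarrow> 'a set \<Rightarrow> bool"
where
  "is_henselization F v K \<longleftrightarrow>
     subfield F \<Omega> \<and> F \<subseteq> K \<and> henselian K v \<and>
     (\<forall>E u. F \<subseteq> E \<and> henselian E u \<and> (\<forall>x\<in>F. u x = v x) \<longrightarrow>
        (\<exists>\<phi>. \<phi> \<in> ring_hom (\<Omega>\<lparr>carrier := K\<rparr>) (\<Omega>\<lparr>carrier := E\<rparr>) \<and>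
             (\<forall>x\<in>F. \<phi> x = x) \<and> (\<forall>x\<in>K. u (\<phi> x) = v x) \<and>
             (\<forall>\<psi>. \<psi> \<in> ring_hom (\<Omega>\<lparr>carrier := K\<rparr>) (\<Omega>\<lparr>carrier := E\<rparr>) \<and>
                   (\<forall>x\<in>F. \<psi> x = x) \<and> (\<forall>x\<in>K. u (\<psi> x) = v x)
                   \<longrightarrow> (\<forall>x\<in>K. \<psi> x = \<phi> x))))"


section \<open>Tame, unramified and ramified extensions\<close>

text \<open>Below, \<open>v\<close> is a valuation of the ambient field, restricted to its subfields.\<close>

definition henselian_extension ::
    "('a::alg_closed_field \<Rightarrow> 'g::divisible_linordered_ab_group_add extended) \<Rightarrow> 'a set \<Rightarrow> 'a set \<Rightarrow> bool"
where
  "henselian_extension v F F' \<longleftrightarrow> henselian F v \<and> henselian F' v \<and> F \<subseteq> F'"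

definition defectless ::
    "('a::alg_closed_field \<Rightarrow> 'g::divisible_linordered_ab_group_add extended) \<Rightarrow> 'a set \<Rightarrow> 'a set \<Rightarrow> bool"
where
  "defectless v F F' \<longleftrightarrow>
     henselian_extension v F F' \<and> ring.finite_dimension \<Omega> F F' \<and>
     ring.dim \<Omega> F F' =
       value_index v F F' * ring.dim (ambient_residue_field v) (residue_set v F) (residue_set v F')"

definition tame ::
    "('a::alg_closed_field \<Rightarrow> 'g::divisible_linordered_ab_group_add extended) \<Rightarrow> 'a set \<Rightarrow> 'a set \<Rightarrow> bool"
where
  "tame v F F' \<longleftrightarrow>
     henselian_extension v F F' \<and> F' \<subseteq> alg_closure_in_ambient F \<and>
     (\<forall>F''. subfield F'' \<Omega> \<and> F \<subseteq> F'' \<and> F'' \<subseteq> F' \<and> ring.finite_dimension \<Omega> F F'' \<longrightarrow>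
        (residue_char v F \<noteq> 0 \<longrightarrow> \<not> residue_char v F dvd value_index v F F'') \<and>
        separable_extension (ambient_residue_field v) (residue_set v F) (residue_set v F'') \<and>
        defectless v F F'')"

definition unramified ::
    "('a::alg_closed_field \<Rightarrow> 'g::divisible_linordered_ab_group_add extended) \<Rightarrow> 'a set \<Rightarrow> 'a set \<Rightarrow> bool"
where
  "unramified v F F' \<longleftrightarrow> tame v F F' \<and> value_group v F' = value_group v F"

definition ramified ::
    "('a::alg_closed_field \<Rightarrow> 'g::divisible_linordered_ab_group_add extended) \<Rightarrow> 'a set \<Rightarrow> 'a set \<Rightarrow> bool"
where
  "ramified v F F' \<longleftrightarrow> henselian_extension v F F' \<and> \<not> unramified v F F'"


section \<open>The lexicographic valuation on \<open>k(X,Y)\<close>\<close>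

text \<open>
  \<open>k[X,Y]\<close> is \<open>k[Y][X]\<close>: the coefficient of \<open>X\<^sup>a Y\<^sup>b\<close> in \<open>f\<close> is
  \<open>poly.coeff (poly.coeff f a) b\<close>.
\<close>

definition poly_X :: "'k::field poly poly" where "poly_X = [:0, 1:]"

definition poly_Y :: "'k::field poly poly" where "poly_Y = [:[:0, 1:]:]"

definition lex_val :: "'k::field poly poly \<Rightarrow> (int \<times> int) extended" where
  "lex_val f = (if f = 0 then Pinf
     else Fin (Min {(int a, int b) | a b. poly.coeff (poly.coeff f a) b \<noteq> 0}))"

text \<open>\<open>\<rat> \<oplus> \<rat>\<close>, ordered lexicographically, is the divisible hull of \<open>\<int> \<oplus> \<int>\<close>.\<close>

definition lex_embed :: "(int \<times> int) extended \<Rightarrow> (rat \<times> rat) extended" where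
  "lex_embed = map_extended (map_prod of_int of_int)"

definition extends_lex_val ::
    "('k::field poly poly fract alg_closure \<Rightarrow> (rat \<times> rat) extended) \<Rightarrow> bool" where
  "extends_lex_val v \<longleftrightarrow>
     (\<forall>f g. g \<noteq> 0 \<longrightarrow> v (to_ac (Fract f g)) = lex_embed (lex_val f - lex_val g))"

abbreviation rational_functions :: "'k::field poly poly fract alg_closure set" where
  "rational_functions \<equiv> range to_ac"

end

theory Submission
  imports Defs
begin

text \<open>
  The square root of \<open>X\<close> lies in \<open>L\<close> and has value \<open>(1/2, 0)\<close>.  The point is that no element of
  \<open>L2\<close> has this value; then the value groups of \<open>L\<close> and \<open>L2\<close> differ and the extension is ramified.

  The henselization \<open>K\<close> is known only by its universal property, which is used through automorphisms.
  The algebraically closed field \<open>\<Omega>\<close> around \<open>K\<close> is henselian, so there is only one valued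
  embedding of \<open>K\<close> into \<open>\<Omega>\<close> over \<open>k(X,Y)\<close>.  Hence every automorphism \<open>\<sigma>\<close> of \<open>\<Omega>\<close> over \<open>k(X,Y)\<close>
  with \<open>v \<circ> \<sigma> = v\<close> fixes \<open>K\<close> pointwise (\<open>henselization_fixed\<close>).  Let \<open>s\<close> and \<open>t\<close> be the square roots
  of \<open>X\<close> and \<open>Y\<close>.  Suppose that \<open>\<sigma>\<close> moreover fixes \<open>t\<close>, maps \<open>s\<close> to \<open>- s\<close>, and fixes a ring \<open>C\<close> of
  representatives of the residue field of \<open>\<Omega>\<close>.  If some \<open>z\<close> in \<open>L2 = K(t)\<close> had the value of \<open>s\<close>,
  then \<open>x = z / s\<close> would be a unit with \<open>\<sigma> x = - x\<close>, and congruent to some \<open>c \<in> C\<close>.  Applying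
  \<open>\<sigma>\<close> makes \<open>- x\<close> congruent to \<open>c\<close> too, so \<open>2 x\<close> has positive value, which is impossible in
  characteristic other than \<open>2\<close> (\<open>value_not_attained\<close>).

  The ring \<open>C\<close> exists by Zorn's lemma (\<open>representatives_exist\<close>).  The automorphism is first defined on
  the field of fractions of \<open>C[s,t]\<close>, where it preserves values because the value of a polynomial
  expression is that of its lowest monomial (\<open>lowest_monomial\<close>).  It extends to \<open>\<Omega>\<close> by Zorn's
  lemma again (\<open>extend_to_all\<close>).  The step that adjoins one algebraic element is the conjugacy of the
  extensions of a valuation, in the following elementary form: the roots of a polynomial cannot all
  be nonintegral if the conjugate polynomial has an integral root
  (\<open>exists_integral_conjugate\<close>); and if every choice of a conjugate went wrong, generic
  \<open>C\<close>-linear combinations would produce one element that is integral and has only nonintegral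
  conjugates (\<open>extend_one_step\<close>).

  Finally, \<open>L\<close> and \<open>L2\<close> are henselian because uniqueness of the extended valuation is inherited by
  algebraic extensions (\<open>henselian_algebraic_extension\<close>).
\<close>

section \<open>Subrings and ring isomorphisms between subrings, as sets\<close>

definition is_subring :: "'a::comm_ring_1 set \<Rightarrow> bool" where
  "is_subring A \<longleftrightarrow> 1 \<in> A \<and> (\<forall>x\<in>A. - x \<in> A) \<and> (\<forall>x\<in>A. \<forall>y\<in>A. x + y \<in> A \<and> x * y \<in> A)"

text \<open>
  A ring isomorphism between two subrings is represented by its graph.  Then a partial isomorphism
  is extended by a larger set, and Zorn's lemma applies to inclusion.
\<close>

definition ring_graph :: "('a::comm_ring_1 \<times> 'a) set \<Rightarrow> bool" where
  "ring_graph R \<longleftrightarrow> (1, 1) \<in> R \<and> (\<forall>x x'. (x, x') \<in> R \<longrightarrow> (- x, - x') \<in> R) \<and>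
     (\<forall>x x' y y'. (x, x') \<in> R \<longrightarrow> (y, y') \<in> R \<longrightarrow> (x + y, x' + y') \<in> R \<and> (x * y, x' * y') \<in> R)"

text \<open>
  The condition on \<open>0\<close> makes the relation single-valued and injective, because it is closed
  under differences.
\<close>

definition field_graph :: "('a::field \<times> 'a) set \<Rightarrow> bool" where
  "field_graph R \<longleftrightarrow> ring_graph R \<and> (\<forall>x x'. (x, x') \<in> R \<longrightarrow> (inverse x, inverse x') \<in> R) \<and>
     (\<forall>x x'. (x, x') \<in> R \<longrightarrow> (x = 0 \<longleftrightarrow> x' = 0))"

definition polys_over :: "'a::comm_ring_1 set \<Rightarrow> 'a poly set" where
  "polys_over A = {p. \<forall>i. poly.coeff p i \<in> A}"

definition graph_over :: "('a::comm_ring_1 \<times> 'a) set \<Rightarrow> ('a poly \<times> 'a poly) set" where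
  "graph_over R = {(p, q). \<forall>i. (poly.coeff p i, poly.coeff q i) \<in> R}"

lemma ring_graphD:
  assumes "ring_graph R"
  shows ring_graph_one: "(1, 1) \<in> R"
    and ring_graph_uminus: "(x, x') \<in> R \<Longrightarrow> (- x, - x') \<in> R"
    and ring_graph_add: "(x, x') \<in> R \<Longrightarrow> (y, y') \<in> R \<Longrightarrow> (x + y, x' + y') \<in> R"
    and ring_graph_mult: "(x, x') \<in> R \<Longrightarrow> (y, y') \<in> R \<Longrightarrow> (x * y, x' * y') \<in> R"
  using assms unfolding ring_graph_def by blast+

lemma ring_graph_zero: "ring_graph R \<Longrightarrow> (0, 0) \<in> R"
  using ring_graph_add[of R 1 1 "-1" "-1"] ring_graph_uminus[of R 1 1] ring_graph_one[of R] by simp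

lemma ring_graph_diff:
  "ring_graph R \<Longrightarrow> (x, x') \<in> R \<Longrightarrow> (y, y') \<in> R \<Longrightarrow> (x - y, x' - y') \<in> R"
  using ring_graph_add[of R x x' "- y" "- y'"] ring_graph_uminus[of R y y'] by simp

lemma ring_graph_sum:
  assumes "ring_graph R" "\<And>i. i \<in> I \<Longrightarrow> (f i, g i) \<in> R"
  shows "(sum f I, sum g I) \<in> R"
  using assms(2)
  by (induction I rule: infinite_finite_induct)
     (auto simp: ring_graph_zero[OF assms(1)] intro!: ring_graph_add[OF assms(1)])

lemma ring_graph_power: "ring_graph R \<Longrightarrow> (x, x') \<in> R \<Longrightarrow> (x ^ n, x' ^ n) \<in> R"
  by (induction n) (auto simp: ring_graph_one intro: ring_graph_mult)

lemma ring_graph_graph_over: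
  assumes R: "ring_graph R"
  shows "ring_graph (graph_over R)"
  unfolding ring_graph_def graph_over_def
  by (auto simp: coeff_mult ring_graph_zero[OF R] ring_graph_one[OF R]
           intro!: ring_graph_sum[OF R] intro: ring_graphD[OF R])

lemma graph_overD: "(p, q) \<in> graph_over R \<Longrightarrow> (poly.coeff p i, poly.coeff q i) \<in> R"
  by (simp add: graph_over_def)

lemma graph_over_pCons:
  "(pCons a p, pCons b q) \<in> graph_over R \<longleftrightarrow> (a, b) \<in> R \<and> (p, q) \<in> graph_over R"
proof -
  have "(\<forall>i. P i) \<longleftrightarrow> P 0 \<and> (\<forall>i. P (Suc i))" for P :: "nat \<Rightarrow> bool"
    by (metis not0_implies_Suc)
  from this[of "\<lambda>i. (poly.coeff (pCons a p) i, poly.coeff (pCons b q) i) \<in> R"]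
  show ?thesis by (simp add: graph_over_def)
qed

lemma graph_over_const: "ring_graph R \<Longrightarrow> (a, b) \<in> R \<Longrightarrow> ([:a:], [:b:]) \<in> graph_over R"
  using ring_graph_zero[OF ring_graph_graph_over] by (auto simp: graph_over_pCons)

lemma graph_over_var: "ring_graph R \<Longrightarrow> ([:0, 1:], [:0, 1:]) \<in> graph_over R"
  using ring_graph_zero ring_graph_one ring_graph_zero[OF ring_graph_graph_over]
  by (auto simp: graph_over_pCons)

lemma graph_over_mono: "R \<subseteq> S \<Longrightarrow> graph_over R \<subseteq> graph_over S"
  by (auto simp: graph_over_def)

lemma poly_eq_sum: "n \<ge> Polynomial.degree p \<Longrightarrow> poly p x = (\<Sum>i\<le>n. poly.coeff p i * x ^ i)"
  for x :: "'a::comm_ring_1"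
  unfolding poly_altdef by (rule sum.mono_neutral_left) (auto simp: coeff_eq_0)

lemma ring_graph_poly:
  assumes "ring_graph R" "(p, q) \<in> graph_over R" "(x, y) \<in> R"
  shows "(poly p x, poly q y) \<in> R"
proof -
  let ?n = "max (Polynomial.degree p) (Polynomial.degree q)"
  have "(\<Sum>i\<le>?n. poly.coeff p i * x ^ i, \<Sum>i\<le>?n. poly.coeff q i * y ^ i) \<in> R"
    using assms graph_overD
    by (intro ring_graph_sum) (auto intro!: ring_graph_mult ring_graph_power)
  then show ?thesis
    using poly_eq_sum[of p ?n x] poly_eq_sum[of q ?n y] by simp
qed

lemma is_subring_iff_ring_graph: "is_subring A \<longleftrightarrow> ring_graph (Id_on A)"
  unfolding is_subring_def ring_graph_def Id_on_iff by blast

lemma polys_over_iff_graph_over: "p \<in> polys_over A \<longleftrightarrow> (p, p) \<in> graph_over (Id_on A)"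
  by (simp add: polys_over_def graph_over_def Id_on_iff)

lemma subringD:
  assumes "is_subring A"
  shows subring_zero: "0 \<in> A" and subring_one: "1 \<in> A"
    and subring_uminus: "x \<in> A \<Longrightarrow> - x \<in> A"
    and subring_add: "x \<in> A \<Longrightarrow> y \<in> A \<Longrightarrow> x + y \<in> A"
    and subring_diff: "x \<in> A \<Longrightarrow> y \<in> A \<Longrightarrow> x - y \<in> A"
    and subring_mult: "x \<in> A \<Longrightarrow> y \<in> A \<Longrightarrow> x * y \<in> A"
  using ring_graph_zero[of "Id_on A"] ring_graph_diff[of "Id_on A" x x y y] assms
  unfolding is_subring_iff_ring_graph[symmetric] Id_on_iff by (auto simp: is_subring_def)

lemma subring_power: "is_subring A \<Longrightarrow> x \<in> A \<Longrightarrow> x ^ n \<in> A"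
  by (induction n) (auto intro: subringD)

lemma subring_polys_over:
  assumes "is_subring A" shows "is_subring (polys_over A)"
proof -
  have "ring_graph (graph_over (Id_on A))"
    using assms by (simp add: is_subring_iff_ring_graph ring_graph_graph_over)
  moreover have "polys_over A = {p. (p, p) \<in> graph_over (Id_on A)}"
    by (auto simp: polys_over_iff_graph_over)
  ultimately show ?thesis
    unfolding is_subring_def ring_graph_def by simp
qed

lemma subring_poly: "is_subring A \<Longrightarrow> p \<in> polys_over A \<Longrightarrow> x \<in> A \<Longrightarrow> poly p x \<in> A"
  using ring_graph_poly[of "Id_on A" p p x x]
  by (simp add: is_subring_iff_ring_graph polys_over_iff_graph_over Id_on_iff)

lemma polys_over_pCons: "pCons a p \<in> polys_over A \<longleftrightarrow> a \<in> A \<and> p \<in> polys_over A"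
  by (simp add: polys_over_iff_graph_over graph_over_pCons Id_on_iff)

lemma polys_over_const: "is_subring A \<Longrightarrow> a \<in> A \<Longrightarrow> [:a:] \<in> polys_over A"
  by (simp add: polys_over_pCons subring_zero subring_polys_over)

lemma polys_over_var: "is_subring A \<Longrightarrow> [:0, 1:] \<in> polys_over A"
  by (simp add: polys_over_pCons subring_zero subring_one subring_polys_over)

lemma polys_over_mono: "A \<subseteq> B \<Longrightarrow> polys_over A \<subseteq> polys_over B"
  by (auto simp: polys_over_def)

lemma field_graphD:
  assumes "field_graph R"
  shows field_graph_ring: "ring_graph R"
    and field_graph_inverse: "(x, x') \<in> R \<Longrightarrow> (inverse x, inverse x') \<in> R"
    and field_graph_zero_iff: "(x, x') \<in> R \<Longrightarrow> x = 0 \<longleftrightarrow> x' = 0"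
  using assms unfolding field_graph_def by auto

lemma field_graph_unique_right: "field_graph R \<Longrightarrow> (x, y) \<in> R \<Longrightarrow> (x, y') \<in> R \<Longrightarrow> y = y'"
  using ring_graph_diff[of R x y x y'] field_graphD(1)[of R] field_graphD(3)[of R 0 "y - y'"] by simp

lemma field_graph_divide:
  "field_graph R \<Longrightarrow> (x, x') \<in> R \<Longrightarrow> (y, y') \<in> R \<Longrightarrow> (x / y, x' / y') \<in> R"
  unfolding field_class.field_divide_inverse
  by (rule ring_graph_mult[OF field_graph_ring _ field_graph_inverse])

lemma field_graph_power_int:
  "field_graph R \<Longrightarrow> (x, x') \<in> R \<Longrightarrow> (x powi n, x' powi n) \<in> R"
  unfolding power_int_def
  using field_graph_ring ring_graph_power field_graph_inverse by (metis (full_types))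

text \<open>If a ring isomorphism respects \<open>x = 0\<close>, so does its extension to fields of fractions.\<close>

lemma field_graph_fractions:
  assumes R: "ring_graph R" and z: "\<And>x x'. (x, x') \<in> R \<Longrightarrow> x = 0 \<longleftrightarrow> x' = 0"
  shows "field_graph {(x / y, x' / y') | x x' y y'. (x, x') \<in> R \<and> (y, y') \<in> R \<and> y \<noteq> 0}"
    (is "field_graph ?S")
proof -
  define Q where "Q = ?S"
  have E: "\<exists>x x' y y'. (x, x') \<in> R \<and> (y, y') \<in> R \<and> y \<noteq> 0 \<and> a = x / y \<and> a' = x' / y'"
    if "(a, a') \<in> Q" for a a'
    using that unfolding Q_def by blast
  have I: "(x / y, x' / y') \<in> Q" if "(x, x') \<in> R" "(y, y') \<in> R" "y \<noteq> 0" for x x' y y'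
    using that unfolding Q_def by blast
  have "(1, 1) \<in> Q"
    using I[OF ring_graph_one[OF R] ring_graph_one[OF R]] by simp
  moreover have "(- a, - a') \<in> Q \<and> (inverse a, inverse a') \<in> Q \<and> (a = 0 \<longleftrightarrow> a' = 0)"
    if "(a, a') \<in> Q" for a a'
  proof -
    from E that obtain x x' y y'
      where h: "(x, x') \<in> R" "(y, y') \<in> R" "y \<noteq> 0" "a = x / y" "a' = x' / y'"
      by meson
    have "(inverse a, inverse a') \<in> Q"
    proof (cases "x = 0")
      case True
      then have "a = 0" "a' = 0" using h z by auto
      then show ?thesis using I[OF ring_graph_zero[OF R] ring_graph_one[OF R]] by simp
    next
      case False
      then show ?thesis using I[OF h(2,1)] h by simp
    qed
    then show ?thesis
      using h z I[OF ring_graph_uminus[OF R h(1)] h(2,3)] by auto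
  qed
  moreover have "(a + b, a' + b') \<in> Q \<and> (a * b, a' * b') \<in> Q"
    if "(a, a') \<in> Q" "(b, b') \<in> Q" for a a' b b'
  proof -
    from E that obtain x x' y y'
      where h: "(x, x') \<in> R" "(y, y') \<in> R" "y \<noteq> 0" "a = x / y" "a' = x' / y'"
      by meson
    from E that obtain u u' w w'
      where k: "(u, u') \<in> R" "(w, w') \<in> R" "w \<noteq> 0" "b = u / w" "b' = u' / w'"
      by meson
    have nz: "y' \<noteq> 0" "w' \<noteq> 0" using h k z by auto
    have "((x * w + u * y) / (y * w), (x' * w' + u' * y') / (y' * w')) \<in> Q"
      using h k by (intro I) (auto intro!: ring_graph_add[OF R] ring_graph_mult[OF R])
    moreover have "((x * u) / (y * w), (x' * u') / (y' * w')) \<in> Q"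
      using h k by (intro I) (auto intro!: ring_graph_mult[OF R])
    ultimately show ?thesis
      using h k nz by (simp add: add_frac_eq)
  qed
  ultimately show ?thesis
    unfolding field_graph_def ring_graph_def Q_def[symmetric] by blast
qed

section \<open>Extending isomorphisms along algebraic elements\<close>

text \<open>
  For the graph \<open>R\<close> of an isomorphism \<open>\<sigma>\<close> this speaks of all elements being algebraic over the
  domain of \<open>\<sigma>\<close>; the second polynomial is the image of the first under \<open>\<sigma>\<close>.
\<close>

definition algebraic_over :: "('a::comm_ring_1 \<times> 'a) set \<Rightarrow> bool" where
  "algebraic_over R \<longleftrightarrow> (\<forall>a. \<exists>p q. (p, q) \<in> graph_over R \<and> p \<noteq> 0 \<and> poly p a = 0)"

text \<open>
  The assignment \<open>p(a) \<mapsto> (\<sigma> p)(b)\<close>, which may fail to be single-valued.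
\<close>

definition adjoin :: "('a::comm_ring_1 \<times> 'a) set \<Rightarrow> 'a \<Rightarrow> 'a \<Rightarrow> ('a \<times> 'a) set" where
  "adjoin R a b = {(poly p a, poly q b) | p q. (p, q) \<in> graph_over R}"

definition minimal_pair :: "('a::comm_ring_1 \<times> 'a) set \<Rightarrow> 'a \<Rightarrow> 'a poly \<Rightarrow> 'a poly \<Rightarrow> bool" where
  "minimal_pair R a f f' \<longleftrightarrow> (f, f') \<in> graph_over R \<and> f \<noteq> 0 \<and> poly f a = 0 \<and>
     (\<forall>p q. (p, q) \<in> graph_over R \<longrightarrow> p \<noteq> 0 \<longrightarrow> poly p a = 0 \<longrightarrow>
        Polynomial.degree f \<le> Polynomial.degree p)"

lemma algebraic_over_mono: "algebraic_over R \<Longrightarrow> R \<subseteq> S \<Longrightarrow> algebraic_over S"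
  using graph_over_mono unfolding algebraic_over_def by blast

lemma minimal_pair_exists:
  assumes "algebraic_over R" obtains f f' where "minimal_pair R a f f'"
proof -
  let ?P = "\<lambda>n. \<exists>p q. (p, q) \<in> graph_over R \<and> p \<noteq> 0 \<and> poly p a = 0 \<and> Polynomial.degree p = n"
  have ex: "\<exists>n. ?P n" using assms unfolding algebraic_over_def by blast
  obtain p q where pq: "(p, q) \<in> graph_over R" "p \<noteq> 0" "poly p a = 0"
      "Polynomial.degree p = (LEAST n. ?P n)"
    using LeastI_ex[OF ex] by blast
  show ?thesis
    by (rule that[of p q]) (use pq in \<open>auto simp: minimal_pair_def intro!: Least_le\<close>)
qed

lemma ring_graph_adjoin:
  assumes "ring_graph R" shows "ring_graph (adjoin R a b)"
proof -
  note G = ring_graphD[OF ring_graph_graph_over[OF assms]]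
  have I: "(poly p a, poly q b) \<in> adjoin R a b" if "(p, q) \<in> graph_over R" for p q
    using that unfolding adjoin_def by blast
  show ?thesis
    unfolding ring_graph_def
  proof (intro conjI allI impI)
    show "(1, 1) \<in> adjoin R a b" using I[OF G(1)] by simp
  next
    fix x x' assume "(x, x') \<in> adjoin R a b"
    then show "(- x, - x') \<in> adjoin R a b"
      using I G(2) unfolding adjoin_def by (force simp flip: poly_minus)
  next
    fix x x' y y' assume "(x, x') \<in> adjoin R a b" "(y, y') \<in> adjoin R a b"
    then obtain p q r s where h: "(p, q) \<in> graph_over R" "(r, s) \<in> graph_over R"
      "x = poly p a" "x' = poly q b" "y = poly r a" "y' = poly s b"
      unfolding adjoin_def by blast
    show "(x + y, x' + y') \<in> adjoin R a b" "(x * y, x' * y') \<in> adjoin R a b"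
      using I[OF G(3)[OF h(1,2)]] I[OF G(4)[OF h(1,2)]] h by auto
  qed
qed

lemma adjoin_superset:
  assumes "ring_graph R" shows "R \<subseteq> adjoin R a b" "(a, b) \<in> adjoin R a b"
proof -
  have "(poly [:x:] a, poly [:y:] b) \<in> adjoin R a b" if "(x, y) \<in> R" for x y
    using graph_over_const[OF assms that] unfolding adjoin_def by blast
  then show "R \<subseteq> adjoin R a b" by auto
  have "(poly [:0, 1:] a, poly [:0, 1:] b) \<in> adjoin R a b"
    using graph_over_var[OF assms] unfolding adjoin_def by blast
  then show "(a, b) \<in> adjoin R a b" by simp
qed

lemma degree_cancel_lead:
  fixes f g :: "'a::idom poly"
  assumes "f \<noteq> 0" "g \<noteq> 0" "Polynomial.degree f \<le> Polynomial.degree g"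
  shows "[:Polynomial.lead_coeff f:] * g
       - [:Polynomial.lead_coeff g:] * [:0, 1:] ^ (Polynomial.degree g - Polynomial.degree f) * f = 0 \<or>
    Polynomial.degree ([:Polynomial.lead_coeff f:] * g
       - [:Polynomial.lead_coeff g:] * [:0, 1:] ^ (Polynomial.degree g - Polynomial.degree f) * f)
      < Polynomial.degree g"
    (is "?h = 0 \<or> _")
proof -
  define k where "k = Polynomial.degree g - Polynomial.degree f"
  have u: "[:0, 1:] ^ k = Polynomial.monom (1 :: 'a) k" by (simp add: monom_altdef)
  have "Polynomial.degree ?h \<le> Polynomial.degree g"
    unfolding k_def[symmetric] u using assms
    by (intro degree_diff_le) (auto simp: k_def degree_mult_eq degree_monom_eq)
  moreover have "poly.coeff ?h (Polynomial.degree g) = 0"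
    unfolding k_def[symmetric] u using assms
    by (simp add: coeff_monom_mult k_def)
  ultimately show ?thesis
    by (metis eq_zero_or_degree_less)
qed

text \<open>
  The minimal polynomial \<open>f\<close> of \<open>a\<close> divides each \<open>g\<close> with \<open>g(a) = 0\<close>, and \<open>\<sigma>\<close> carries the division
  along.  The division is done one leading term at a time, scaling by leading coefficients instead
  of dividing by them.
\<close>

lemma minimal_pair_dvd:
  assumes R: "field_graph R" and f: "minimal_pair R a f f'" and b: "poly f' b = 0"
    and g: "(g, g') \<in> graph_over R" "poly g a = 0"
  shows "poly g' b = 0"
  using g
  \<comment> \<open>the zero polynomial has to count as smaller than the constants\<close>
proof (induction "if g = 0 then 0 else Suc (Polynomial.degree g)" arbitrary: g g' rule: less_induct)
  case less
  note RR = field_graph_ring[OF R]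
  note G = ring_graph_graph_over[OF RR]
  have f0: "(f, f') \<in> graph_over R" "f \<noteq> 0" "poly f a = 0" using f by (auto simp: minimal_pair_def)
  show ?case
  proof (cases "g = 0")
    case True
    have "poly.coeff g' i = 0" for i
      using graph_overD[OF less(2), of i] field_graph_zero_iff[OF R, of "poly.coeff g i"] True by simp
    then have "g' = 0" by (simp add: poly_eq_iff)
    then show ?thesis by simp
  next
    case False
    define c c' where "c = poly.coeff g (Polynomial.degree g)" "c' = poly.coeff g' (Polynomial.degree g)"
    define d d' where "d = poly.coeff f (Polynomial.degree f)" "d' = poly.coeff f' (Polynomial.degree f)"
    have cd: "(c, c') \<in> R" "(d, d') \<in> R"
      using graph_overD less(2) f0 by (auto simp: c_c'_def d_d'_def)
    have nz: "c \<noteq> 0" "d \<noteq> 0" "d' \<noteq> 0"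
      using False f0 field_graph_zero_iff[OF R cd(2)] by (auto simp: c_c'_def d_d'_def)
    have deg: "Polynomial.degree f \<le> Polynomial.degree g"
      using f less(2,3) False unfolding minimal_pair_def by blast
    define k where "k = Polynomial.degree g - Polynomial.degree f"
    define u :: "'a poly" where "u = [:0, 1:] ^ k"
    define h where "h = [:d:] * g - [:c:] * u * f"
    define h' where "h' = [:d':] * g' - [:c':] * u * f'"
    have hh: "(h, h') \<in> graph_over R"
      unfolding h_def h'_def u_def using less(2) f0 cd
      by (intro ring_graph_diff[OF G] ring_graph_mult[OF G] ring_graph_power[OF G]
            graph_over_const[OF RR] graph_over_var[OF RR])
    have ha: "poly h a = 0" using less(3) f0 by (simp add: h_def)
    have "h = 0 \<or> Polynomial.degree h < Polynomial.degree g"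
      using degree_cancel_lead[OF f0(2) False deg] by (simp add: h_def u_def k_def c_c'_def d_d'_def)
    then have "poly h' b = 0"
      by (intro less(1)[OF _ hh ha]) (use False in auto)
    then show ?thesis using b nz by (simp add: h'_def)
  qed
qed

text \<open>
  The homomorphism property of \<open>p(a) \<mapsto> (\<sigma> p)(b)\<close> for a root \<open>b\<close> of the conjugate minimal
  polynomial is immediate.  Inverses in \<open>N[a]\<close> come from a polynomial relation of minimal degree for the element to be
  inverted: its constant coefficient does not vanish.
\<close>

lemma field_graph_adjoin:
  assumes R: "field_graph R" and alg: "algebraic_over R"
    and f: "minimal_pair R a f f'" and b: "poly f' b = 0"
  shows "field_graph (adjoin R a b)"
proof -
  let ?A = "adjoin R a b"
  note RR = field_graph_ring[OF R]
  note A = ring_graph_adjoin[OF RR, of a b]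
  have z: "x' = 0" if "(x, x') \<in> ?A" "x = 0" for x x'
    using that minimal_pair_dvd[OF R f b] unfolding adjoin_def by blast
  have *: "x' \<noteq> 0 \<and> (inverse x, inverse x') \<in> ?A" if xx: "(x, x') \<in> ?A" and nz: "x \<noteq> 0" for x x'
  proof -
    obtain h h' where h: "minimal_pair R x h h'" using minimal_pair_exists[OF alg] .
    obtain c q where hc: "h = pCons c q" by (cases h)
    obtain c' q' where hc': "h' = pCons c' q'" by (cases h')
    have cc: "(c, c') \<in> R" and qq: "(q, q') \<in> graph_over R"
      using h unfolding minimal_pair_def hc hc' graph_over_pCons by auto
    have e: "c + x * poly q x = 0" using h by (simp add: minimal_pair_def hc)
    have c0: "c \<noteq> 0"
    proof
      assume "c = 0"
      then have "poly q x = 0" "q \<noteq> 0" using e nz h by (auto simp: minimal_pair_def hc)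
      then have "Polynomial.degree h \<le> Polynomial.degree q"
        using h qq unfolding minimal_pair_def by blast
      then show False using \<open>q \<noteq> 0\<close> by (simp add: hc)
    qed
    then have c0': "c' \<noteq> 0" using field_graph_zero_iff[OF R cc] by simp
    have "(h, h') \<in> graph_over ?A" "(q, q') \<in> graph_over ?A"
      using h qq graph_over_mono[OF adjoin_superset(1)[OF RR]] by (auto simp: minimal_pair_def)
    then have hA: "(poly h x, poly h' x') \<in> ?A" and qA: "(poly q x, poly q' x') \<in> ?A"
      using ring_graph_poly[OF A _ xx] by auto
    have "poly h' x' = 0" using z[OF hA] h by (simp add: minimal_pair_def)
    then have e': "c' + x' * poly q' x' = 0" by (simp add: hc')
    have "x' \<noteq> 0" using e' c0' by auto
    have "(- (inverse c * poly q x), - (inverse c' * poly q' x')) \<in> ?A"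
      using field_graph_inverse[OF R cc] adjoin_superset(1)[OF RR, of a b] qA
      by (intro ring_graph_uminus[OF A] ring_graph_mult[OF A]) auto
    moreover have "- (inverse c * poly q x) = inverse x" "- (inverse c' * poly q' x') = inverse x'"
      using e e' c0 c0' nz \<open>x' \<noteq> 0\<close> by (auto simp: field_simps add_eq_0_iff2)
    ultimately show ?thesis using \<open>x' \<noteq> 0\<close> by simp
  qed
  have "(inverse x, inverse x') \<in> ?A" if "(x, x') \<in> ?A" for x x'
    using z[OF that] *[OF that] that by (cases "x = 0") auto
  then show ?thesis
    unfolding field_graph_def using A z * by blast
qed

section \<open>Valuation rings\<close>

text \<open>
  Only the valuation ring matters for extending isomorphisms; values return at the end, since
  some positive multiple of each value is the value of a monomial.
\<close>

locale valuation_subring =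
  fixes V :: "'a::field set"
  assumes subring: "is_subring V"
    and inverse_mem: "x \<notin> V \<Longrightarrow> inverse x \<in> V"
begin

text \<open>The maximal ideal.\<close>

definition M :: "'a set" where
  "M = {x \<in> V. x = 0 \<or> inverse x \<notin> V}"

definition preserves :: "('a \<times> 'a) set \<Rightarrow> bool" where
  "preserves R \<longleftrightarrow> (\<forall>x x'. (x, x') \<in> R \<longrightarrow> (x \<in> V \<longleftrightarrow> x' \<in> V))"

lemmas V_zero = subring_zero[OF subring] and V_one = subring_one[OF subring]
  and V_uminus = subring_uminus[OF subring] and V_add = subring_add[OF subring]
  and V_diff = subring_diff[OF subring] and V_mult = subring_mult[OF subring]

lemma M_subset: "x \<in> M \<Longrightarrow> x \<in> V"
  by (simp add: M_def)

lemma M_zero: "0 \<in> M"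
  by (simp add: M_def V_zero)

lemma one_notin_M: "1 \<notin> M"
  by (simp add: M_def V_one)

lemma unit_inverse: "x \<in> V \<Longrightarrow> x \<notin> M \<Longrightarrow> inverse x \<in> V"
  by (auto simp: M_def)

lemma inverse_M: "x \<notin> V \<Longrightarrow> inverse x \<in> M"
  using inverse_mem[of x] by (simp add: M_def)

lemma M_inverse: "x \<in> M \<Longrightarrow> x \<noteq> 0 \<Longrightarrow> inverse x \<notin> V"
  by (simp add: M_def)

lemma M_mult: assumes "x \<in> M" "y \<in> V" shows "x * y \<in> M"
proof -
  have "x = 0" if "inverse (x * y) \<in> V" "x * y \<noteq> 0"
  proof -
    have "y * inverse (x * y) \<in> V" using that assms V_mult by blast
    moreover have "y * inverse (x * y) = inverse x" using that by simp
    ultimately have "inverse x \<in> V" by metis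
    then show ?thesis using assms by (simp add: M_def)
  qed
  then show ?thesis using assms V_mult[of x y] by (auto simp: M_def)
qed

lemma M_add: assumes "x \<in> M" "y \<in> M" shows "x + y \<in> M"
proof -
  have *: "x + y \<in> M" if "x \<in> M" "y \<in> M" "x / y \<in> V" "y \<noteq> 0" for x y
  proof -
    have "y * (1 + x / y) \<in> M" using that by (intro M_mult V_add V_one)
    moreover have "y * (1 + x / y) = x + y" using that by (simp add: distrib_left)
    ultimately show ?thesis by simp
  qed
  show ?thesis
  proof (cases "x = 0 \<or> y = 0")
    case False
    show ?thesis
    proof (cases "x / y \<in> V")
      case f: False
      have "y / x \<in> V" using inverse_mem[OF f] by simp
      then show ?thesis using *[of y x] assms False by (simp add: add.commute)
    qed (use * assms False in auto)
  qed (use assms in auto)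
qed

lemma M_uminus: "x \<in> M \<Longrightarrow> - x \<in> M"
  using M_mult[of x "- 1"] V_uminus[OF V_one] by simp

lemma M_diff: "x \<in> M \<Longrightarrow> y \<in> M \<Longrightarrow> x - y \<in> M"
  using M_add[of x "- y"] M_uminus[of y] by simp

lemma notin_M_iff: "x \<notin> M \<longleftrightarrow> x \<noteq> 0 \<and> inverse x \<in> V"
  using inverse_mem[of x] by (auto simp: M_def V_zero)

lemma M_prime: "x * y \<in> M \<Longrightarrow> x \<in> M \<or> y \<in> M"
  using notin_M_iff[of x] notin_M_iff[of y] notin_M_iff[of "x * y"] V_mult by auto

lemma unit_plus_M: "c \<in> V \<Longrightarrow> c \<notin> M \<Longrightarrow> m \<in> M \<Longrightarrow> c + m \<in> V - M"
  using M_diff[of "c + m" m] V_add[of c m] M_subset by auto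

lemma V_prod: "(\<And>i. i \<in> I \<Longrightarrow> g i \<in> V) \<Longrightarrow> prod g I \<in> V"
  by (induction I rule: infinite_finite_induct) (auto intro: V_one V_mult)

lemma poly_M: "(\<And>i. poly.coeff p i \<in> M) \<Longrightarrow> y \<in> V \<Longrightarrow> poly p y \<in> M"
proof (induction p)
  case (pCons a p)
  have "poly.coeff p i \<in> M" for i using pCons(3)[of "Suc i"] by simp
  then have "poly p y * y \<in> M" using pCons by (intro M_mult) auto
  then show ?case using pCons(3)[of 0] M_add[of a] by (simp add: mult.commute)
qed (simp add: M_zero)

lemma preserves_M:
  assumes "field_graph R" "preserves R" "(x, x') \<in> R"
  shows "x \<in> M \<longleftrightarrow> x' \<in> M"
  using assms field_graph_inverse[OF assms(1,3)] field_graph_zero_iff[OF assms(1,3)]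
  by (auto simp: M_def preserves_def)

end

locale closed_valuation_subring = valuation_subring V for V :: "'a::alg_closed_field set"

lemma poly_root: "Polynomial.degree q > 0 \<Longrightarrow> \<exists>x :: 'a::alg_closed_field. poly q x = 0"
  using alg_closed_imp_poly_has_root by blast

text \<open>
  A case of the Newton polygon: the polynomial is a constant times a product of factors \<open>1 - T / r\<close> with
  \<open>1 / r\<close> in the maximal ideal.
\<close>

lemma (in closed_valuation_subring) coeffs_of_roots_outside:
  "p \<noteq> 0 \<Longrightarrow> (\<And>r. poly p r = 0 \<Longrightarrow> r \<notin> V) \<Longrightarrow> i > 0 \<Longrightarrow>
    poly.coeff p i / poly.coeff p 0 \<in> M"
proof (induction "Polynomial.degree p" arbitrary: p i)
  case 0
  then show ?case by (simp add: coeff_eq_0 M_zero)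
next
  case (Suc n)
  obtain r where r: "poly p r = 0" using poly_root[of p] Suc(2) by auto
  then obtain q where q: "p = [:- r, 1:] * q" by (auto simp: poly_eq_0_iff_dvd)
  have rV: "r \<notin> V" using Suc r by simp
  have r0: "r \<noteq> 0" using rV V_zero by auto
  have q0: "q \<noteq> 0" using Suc q by auto
  have "Polynomial.degree p = Suc (Polynomial.degree q)"
    unfolding q by (subst degree_mult_eq) (use q0 in auto)
  then have n: "n = Polynomial.degree q" using Suc(2) by simp
  have IH: "poly.coeff q i / poly.coeff q 0 \<in> M" if "i > 0" for i
    using Suc(1)[OF n q0 _ that] Suc(4) by (simp add: q)
  have "poly p 0 \<noteq> 0" using Suc(4)[of 0] V_zero by auto
  then have c0: "poly.coeff q 0 \<noteq> 0" by (auto simp: q poly_0_coeff_0)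
  obtain j where j: "i = Suc j" using Suc(5) by (cases i) auto
  have "poly.coeff q j / poly.coeff q 0 \<in> V"
    using IH[of j] c0 V_one M_subset by (cases j) auto
  then have "inverse r * (poly.coeff q j / poly.coeff q 0) \<in> M"
    by (intro M_mult inverse_M rV)
  then have "poly.coeff q (Suc j) / poly.coeff q 0 - inverse r * (poly.coeff q j / poly.coeff q 0) \<in> M"
    using IH[of "Suc j"] M_diff by simp
  moreover have "poly.coeff p i = poly.coeff q j - r * poly.coeff q (Suc j)"
    "poly.coeff p 0 = - r * poly.coeff q 0"
    by (simp_all add: q j)
  moreover from this have "poly.coeff p i / poly.coeff p 0 =
      poly.coeff q (Suc j) / poly.coeff q 0 - inverse r * (poly.coeff q j / poly.coeff q 0)"
    using r0 c0 by (simp add: divide_simps)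
  ultimately show ?case by simp
qed

text \<open>
  The constant term has strictly smaller value than all other terms, so the terms cannot cancel.
\<close>

lemma (in valuation_subring) no_integral_root:
  assumes "poly.coeff p 0 \<noteq> 0" "\<And>i. i > 0 \<Longrightarrow> poly.coeff p i / poly.coeff p 0 \<in> M" "y \<in> V"
  shows "poly p y \<noteq> 0"
proof
  assume 0: "poly p y = 0"
  obtain c q where p: "p = pCons c q" by (cases p)
  have "poly (Polynomial.smult (inverse c) q) y \<in> M"
    using assms(2)[of "Suc i" for i] assms(3)
    by (intro poly_M) (auto simp: p field_class.field_divide_inverse mult.commute)
  then have "y * (inverse c * poly q y) \<in> M"
    using M_mult[OF _ assms(3), of "inverse c * poly q y"] by (simp add: mult.commute)
  moreover have "y * (inverse c * poly q y) = - 1"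
    using 0 assms(1) by (simp add: p field_simps add_eq_0_iff2)
  ultimately show False using M_uminus one_notin_M by fastforce
qed

section \<open>Extending isomorphisms that preserve a valuation ring\<close>

text \<open>\<open>C\<close> is a ring of representatives for the residue field.\<close>

locale valuation_subring_with_representatives = closed_valuation_subring V
  for V :: "'a::alg_closed_field set" +
  fixes C :: "'a set"
  assumes C_subring: "is_subring C" and C_subset: "C \<subseteq> V"
    and C_M: "\<And>c. c \<in> C \<Longrightarrow> c \<in> M \<Longrightarrow> c = 0"
    and residue: "\<And>x. x \<in> V \<Longrightarrow> \<exists>c\<in>C. x - c \<in> M"
begin

text \<open>
  If \<open>C\<close> were finite, a root \<open>t\<close> of \<open>(\<Prod>c\<in>C. T - c) + 1\<close> would be integral but differ by a unit
  from every representative.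
\<close>

lemma infinite_C: "infinite C"
proof
  assume fin: "finite C"
  have deg: "Polynomial.degree (\<Prod>c\<in>C. [:- c, 1:]) = card C"
    by (subst degree_prod_eq_sum_degree) auto
  have "card C > 0" using fin subring_zero[OF C_subring] by (auto simp: card_gt_0_iff)
  then have "Polynomial.degree ((\<Prod>c\<in>C. [:- c, 1:]) + 1) > 0"
    using deg by (simp add: degree_add_eq_left)
  then obtain t where "poly ((\<Prod>c\<in>C. [:- c, 1:]) + 1) t = 0" using poly_root by blast
  then have t: "(\<Prod>c\<in>C. t - c) = - 1" by (simp add: poly_prod add_eq_0_iff2)
  have prod_M: "(\<Prod>c\<in>C. g c) \<in> M" if "c0 \<in> C" "g c0 \<in> M" "\<And>c. c \<in> C \<Longrightarrow> g c \<in> V" for c0 g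
  proof -
    have "(\<Prod>c\<in>C - {c0}. g c) \<in> V"
      using that(3) by (intro V_prod) auto
    then show ?thesis using M_mult[OF that(2)] by (simp add: prod.remove[OF fin that(1)])
  qed
  show False
  proof (cases "t \<in> V")
    case True
    obtain c where "c \<in> C" "t - c \<in> M" using residue[OF True] by blast
    then have "- 1 \<in> M" using prod_M[of c "\<lambda>c. t - c"] t True C_subset V_diff by auto
    then show ?thesis using M_uminus one_notin_M by fastforce
  next
    case False
    have "inverse (t - c) \<in> M" if "c \<in> C" for c
      using V_add[of "t - c" c] that False C_subset by (intro inverse_M) auto
    then have "(\<Prod>c\<in>C. inverse (t - c)) \<in> M"
      using subring_zero[OF C_subring] M_subset by (intro prod_M) auto
    then have "- 1 \<in> M" using t prod_inversef[of "\<lambda>c. t - c" C] by (simp add: comp_def)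
    then show ?thesis using M_uminus one_notin_M by fastforce
  qed
qed

lemma minimal_pair_root:
  assumes R: "field_graph R" and f: "minimal_pair R a f f'"
  shows "f' \<noteq> 0" "\<exists>b :: 'a. poly f' b = 0"
proof -
  have f0: "(f, f') \<in> graph_over R" "f \<noteq> 0" "poly f a = 0" using f by (auto simp: minimal_pair_def)
  have "Polynomial.degree f > 0"
    using f0 by (metis degree_eq_zeroE gr0I pCons_eq_0_iff poly_0 poly_const_conv)
  moreover have "poly.coeff f' (Polynomial.degree f) \<noteq> 0"
    using field_graph_zero_iff[OF R graph_overD[OF f0(1), of "Polynomial.degree f"]] f0 by auto
  ultimately have "Polynomial.degree f' > 0" by (meson le_degree less_le_trans)
  then show "f' \<noteq> 0" "\<exists>b :: 'a. poly f' b = 0" using poly_root by auto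
qed

text \<open>
  The valuation ring of \<open>N\<close>, the domain of \<open>\<sigma>\<close>, determines whether a polynomial over \<open>N\<close> has an
  integral root.  Since \<open>y = g(a)\<close> is integral, the conjugate of its minimal polynomial \<open>h\<close> cannot
  have all its roots outside \<open>V\<close>.  A root \<open>c\<close> of that polynomial is the image of \<open>y\<close> under an
  isomorphism that extends \<open>\<sigma>\<close> to \<open>N(y)\<close> and further to \<open>N(a)\<close>, so it has the form \<open>(\<sigma> g)(b)\<close>
  with \<open>b\<close> a root of \<open>f'\<close>.
\<close>

lemma exists_integral_conjugate:
  assumes R: "field_graph R" and pres: "preserves R" and alg: "algebraic_over R"
    and f: "minimal_pair R a f f'" and g: "(g, g') \<in> graph_over R" "poly g a \<in> V"
  shows "\<exists>b. poly f' b = 0 \<and> poly g' b \<in> V"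
proof (rule ccontr)
  assume neg: "\<nexists>b. poly f' b = 0 \<and> poly g' b \<in> V"
  define y where "y = poly g a"
  obtain h h' where h: "minimal_pair R y h h'" using minimal_pair_exists[OF alg] .
  then have h0: "(h, h') \<in> graph_over R" "poly h y = 0" by (auto simp: minimal_pair_def)
  have out: "c \<notin> V" if c: "poly h' c = 0" for c
  proof -
    let ?A = "adjoin R y c"
    note A = field_graph_adjoin[OF R alg h c]
    note RA = adjoin_superset[OF field_graph_ring[OF R], of y c]
    note algA = algebraic_over_mono[OF alg RA(1)]
    obtain k k' where k: "minimal_pair ?A a k k'" using minimal_pair_exists[OF algA] .
    obtain b where b: "poly k' b = 0" using minimal_pair_root[OF A k] by blast
    let ?B = "adjoin ?A a b"
    note B = field_graph_adjoin[OF A algA k b]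
    note AB = adjoin_superset[OF field_graph_ring[OF A], of a b]
    have RB: "graph_over R \<subseteq> graph_over ?B" using RA AB graph_over_mono by (meson order_trans)
    have "(poly f a, poly f' b) \<in> ?B" "(poly g a, poly g' b) \<in> ?B"
      using f g RB ring_graph_poly[OF field_graph_ring[OF B] _ AB(2)]
      unfolding minimal_pair_def by blast+
    moreover have "(poly g a, c) \<in> ?B" using RA AB by (auto simp: y_def)
    ultimately have "poly f' b = 0" "c = poly g' b"
      using field_graph_zero_iff[OF B] field_graph_unique_right[OF B] f by (auto simp: minimal_pair_def)
    then show ?thesis using neg by auto
  qed
  have h'0: "poly.coeff h' 0 \<noteq> 0" using out[of 0] V_zero by (auto simp: poly_0_coeff_0)
  have h00: "poly.coeff h 0 \<noteq> 0"
    using h'0 field_graph_zero_iff[OF R graph_overD[OF h0(1)]] by blast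
  have "poly.coeff h i / poly.coeff h 0 \<in> M" if "i > 0" for i
    using coeffs_of_roots_outside[OF minimal_pair_root(1)[OF R h] out that]
      preserves_M[OF R pres field_graph_divide[OF R graph_overD[OF h0(1)] graph_overD[OF h0(1)]]]
    by blast
  then show False using no_integral_root[OF h00 _ g(2)] h0 by (simp add: y_def)
qed

text \<open>
  A failure to preserve \<open>V\<close> can always be turned into an integral element with a nonintegral
  image.  If a nonintegral \<open>x\<close> has an integral image \<open>x'\<close>, then \<open>1 / x\<close> is such an element unless
  \<open>x'\<close> is a unit; in that case take \<open>1 / (1 / x - c)\<close> for the representative \<open>c\<close> of \<open>1 / x'\<close>.
\<close>

lemma not_preserves_adjoin:
  assumes R: "field_graph (adjoin R a b)" and C: "Id_on C \<subseteq> adjoin R a b" and "\<not> preserves (adjoin R a b)"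
  shows "\<exists>g g'. (g, g') \<in> graph_over R \<and> poly g a \<in> V \<and> poly g' b \<notin> V"
proof -
  let ?A = "adjoin R a b"
  have "\<exists>y y'. (y, y') \<in> ?A \<and> y \<in> V \<and> y' \<notin> V"
  proof -
    obtain x x' where x: "(x, x') \<in> ?A" "\<not> (x \<in> V \<longleftrightarrow> x' \<in> V)"
      using assms(3) unfolding preserves_def by blast
    note ix = field_graph_inverse[OF R x(1)]
    note zx = field_graph_zero_iff[OF R x(1)]
    consider "x \<in> V" "x' \<notin> V" | "x \<notin> V" "x' \<in> M" | "x \<notin> V" "x' \<in> V" "x' \<notin> M"
      using x(2) M_subset by blast
    then show ?thesis
    proof cases
      case 2
      have "x' \<noteq> 0" using 2 zx V_zero by auto
      then have "inverse x' \<notin> V" using 2 by (auto simp: M_def)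
      then show ?thesis using ix inverse_mem[OF 2(1)] by blast
    next
      case 3
      obtain c where c: "c \<in> C" "inverse x' - c \<in> M"
        using residue[OF unit_inverse[OF 3(2,3)]] by blast
      have x'0: "x' \<noteq> 0" using 3 M_zero by auto
      have "c \<noteq> 0"
      proof
        assume "c = 0"
        then have "inverse x' * x' \<in> M" using c 3 M_mult by simp
        then show False using x'0 one_notin_M by simp
      qed
      then have cM: "c \<notin> M" using C_M c by blast
      have y: "(inverse x - c, inverse x' - c) \<in> ?A"
        using ring_graph_diff[OF field_graph_ring[OF R] ix] C c by blast
      have "inverse x - c \<in> V" "inverse x - c \<notin> M"
        using unit_plus_M[of "- c" "inverse x"] inverse_M[OF 3(1)] cM c C_subset V_uminus M_uminus[of "- c"]
        by auto
      then have "inverse (inverse x - c) \<in> V" "inverse x - c \<noteq> 0"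
        using unit_inverse M_zero by auto
      moreover have "inverse (inverse x' - c) \<notin> V"
        using M_inverse[OF c(2)] field_graph_zero_iff[OF R y] calculation by blast
      ultimately show ?thesis using field_graph_inverse[OF R y] by blast
    qed (use x in blast)
  qed
  then show ?thesis unfolding adjoin_def by blast
qed

text \<open>
  Suppose that each conjugate \<open>b\<close> of \<open>a\<close> fails, as witnessed by an integral element of \<open>N(a)\<close> with
  nonintegral image.  The witnesses for different \<open>b\<close> combine into a single one: if \<open>y\<close> or \<open>z\<close> has
  a nonintegral image then so has \<open>y + c z\<close>, for all but at most one \<open>c \<in> C\<close>, and \<open>C\<close> is infinite.
  A common witness contradicts \<open>exists_integral_conjugate\<close>.
\<close>

lemma extend_one_step:
  assumes R: "field_graph R" and pres: "preserves R" and alg: "algebraic_over R" and C: "Id_on C \<subseteq> R"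
  shows "\<exists>b. field_graph (adjoin R a b) \<and> preserves (adjoin R a b)"
proof (rule ccontr)
  assume neg: "\<not> ?thesis"
  note RR = field_graph_ring[OF R]
  note G = ring_graph_graph_over[OF RR]
  obtain f f' where f: "minimal_pair R a f f'" using minimal_pair_exists[OF alg] .
  let ?B = "{b. poly f' b = 0}"
  have finB: "finite ?B" using poly_roots_finite[OF minimal_pair_root(1)[OF R f]] .
  have bad: "\<exists>g g'. (g, g') \<in> graph_over R \<and> poly g a \<in> V \<and> poly g' b \<notin> V" if "b \<in> ?B" for b
    using not_preserves_adjoin[of R a b] field_graph_adjoin[OF R alg f, of b] that neg
      adjoin_superset(1)[OF RR, of a b] C by blast
  have "\<exists>g g'. (g, g') \<in> graph_over R \<and> poly g a \<in> V \<and> (\<forall>b\<in>B. poly g' b \<notin> V)"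
    if "finite B" "B \<subseteq> ?B" for B
    using that
  proof (induction B)
    case empty
    show ?case using ring_graph_zero[OF G] V_zero by (intro exI[of _ 0]) auto
  next
    case (insert b0 B)
    obtain g g' where g: "(g, g') \<in> graph_over R" "poly g a \<in> V" "\<forall>b\<in>B. poly g' b \<notin> V"
      using insert by auto
    obtain k k' where k: "(k, k') \<in> graph_over R" "poly k a \<in> V" "poly k' b0 \<notin> V"
      using bad insert by blast
    have "finite {c \<in> C. poly g' b + c * poly k' b \<in> V}" if b: "b \<in> insert b0 B" for b
    proof -
      have "c = d" if h: "c \<in> C" "d \<in> C" "poly g' b + c * poly k' b \<in> V" "poly g' b + d * poly k' b \<in> V" for c d
      proof (rule ccontr)
        assume "c \<noteq> d"
        have cd: "c - d \<in> C" using h subring_diff[OF C_subring] by blast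
        have "c - d \<notin> M" using C_M[OF cd] \<open>c \<noteq> d\<close> by auto
        then have inv: "inverse (c - d) \<in> V" using unit_inverse cd C_subset by blast
        have "(poly g' b + c * poly k' b) - (poly g' b + d * poly k' b) \<in> V" using h V_diff by blast
        then have "(c - d) * poly k' b \<in> V" by (simp add: left_diff_distrib)
        then have "inverse (c - d) * ((c - d) * poly k' b) \<in> V" by (rule V_mult[OF inv])
        moreover have "inverse (c - d) * (c - d) = 1" using \<open>c \<noteq> d\<close> by simp
        ultimately have kV: "poly k' b \<in> V" by (simp only: mult.assoc[symmetric] mult_1_left)
        then have "poly g' b + c * poly k' b - c * poly k' b \<in> V"
          using h C_subset by (intro V_diff V_mult) auto
        then show False using kV k g b by auto
      qed
      then have "{c \<in> C. poly g' b + c * poly k' b \<in> V} \<subseteq> {c}"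
        if "c \<in> C" "poly g' b + c * poly k' b \<in> V" for c
        using that by blast
      then show ?thesis
        by (cases "{c \<in> C. poly g' b + c * poly k' b \<in> V} = {}") (auto intro: finite_subset)
    qed
    then have "finite (\<Union>b\<in>insert b0 B. {c \<in> C. poly g' b + c * poly k' b \<in> V})"
      using insert by blast
    then obtain c where c: "c \<in> C" "c \<notin> (\<Union>b\<in>insert b0 B. {c \<in> C. poly g' b + c * poly k' b \<in> V})"
      using infinite_C by (meson ex_new_if_finite finite_subset subsetI)
    have "(g + [:c:] * k, g' + [:c:] * k') \<in> graph_over R"
      using g k c C by (intro ring_graph_add[OF G] ring_graph_mult[OF G] graph_over_const[OF RR]) auto
    moreover have "poly (g + [:c:] * k) a \<in> V"
      using g k c C_subset by (auto intro!: V_add V_mult)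
    moreover have "\<forall>b\<in>insert b0 B. poly (g' + [:c:] * k') b \<notin> V" using c by auto
    ultimately show ?case by blast
  qed
  from this[OF finB] show False using exists_integral_conjugate[OF R pres alg f] by blast
qed

theorem extend_to_all:
  assumes R: "field_graph R" and pres: "preserves R" and alg: "algebraic_over R" and C: "Id_on C \<subseteq> R"
  shows "\<exists>S. R \<subseteq> S \<and> field_graph S \<and> preserves S \<and> (\<forall>a. \<exists>b. (a, b) \<in> S)"
proof -
  let ?F = "{S. R \<subseteq> S \<and> field_graph S \<and> preserves S}"
  have "\<Union>\<C> \<in> ?F" if ch: "\<C> \<noteq> {}" "subset.chain ?F \<C>" for \<C>
  proof -
    have F: "S \<in> \<C> \<Longrightarrow> R \<subseteq> S \<and> field_graph S \<and> preserves S" for S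
      using ch unfolding subset.chain_def by blast
    have two: "\<exists>S\<in>\<C>. p \<in> S \<and> q \<in> S" if "p \<in> \<Union>\<C>" "q \<in> \<Union>\<C>" for p q
      using that ch unfolding subset.chain_def by blast
    have two_ring: "(x + y, x' + y') \<in> \<Union>\<C> \<and> (x * y, x' * y') \<in> \<Union>\<C>"
      if "(x, x') \<in> \<Union>\<C>" "(y, y') \<in> \<Union>\<C>" for x x' y y'
    proof -
      obtain S where "S \<in> \<C>" "(x, x') \<in> S" "(y, y') \<in> S" using two[OF \<open>(x, x') \<in> \<Union>\<C>\<close> \<open>(y, y') \<in> \<Union>\<C>\<close>] by blast
      then show ?thesis
        using F[of S] ring_graph_add[of S x x' y y'] ring_graph_mult[of S x x' y y'] field_graph_ring[of S] by blast
    qed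
    have one: "(- x, - x') \<in> \<Union>\<C> \<and> (inverse x, inverse x') \<in> \<Union>\<C> \<and> (x = 0 \<longleftrightarrow> x' = 0) \<and> (x \<in> V \<longleftrightarrow> x' \<in> V)"
      if xx: "(x, x') \<in> \<Union>\<C>" for x x'
    proof -
      obtain S where S: "S \<in> \<C>" "(x, x') \<in> S" using xx by blast
      then have "field_graph S" "preserves S" using F by auto
      with S show ?thesis
        using ring_graph_uminus[OF field_graph_ring] field_graph_inverse field_graph_zero_iff
        unfolding preserves_def by blast
    qed
    have "(1, 1) \<in> \<Union>\<C>" "R \<subseteq> \<Union>\<C>"
      using ch F ring_graph_one[OF field_graph_ring[OF R]] by blast+
    then show ?thesis
      unfolding mem_Collect_eq field_graph_def ring_graph_def preserves_def
      using one two_ring by (intro conjI allI impI) auto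
  qed
  moreover have "?F \<noteq> {}" using R pres by blast
  ultimately obtain S where S: "S \<in> ?F" and max: "\<And>T. T \<in> ?F \<Longrightarrow> S \<subseteq> T \<Longrightarrow> T = S"
    using subset_Zorn_nonempty[of ?F] by meson
  have "\<exists>b. (a, b) \<in> S" for a
  proof -
    have h: "field_graph S" "preserves S" "R \<subseteq> S" using S by auto
    obtain b where b: "field_graph (adjoin S a b)" "preserves (adjoin S a b)"
      using extend_one_step[OF h(1,2) algebraic_over_mono[OF alg h(3)]] C h(3) by blast
    note sup = adjoin_superset[OF field_graph_ring[OF h(1)], of a b]
    have "adjoin S a b = S" using max[of "adjoin S a b"] b sup h by auto
    then show ?thesis using sup by auto
  qed
  then show ?thesis using S by blast
qed

end

section \<open>A ring of representatives for the residue field\<close>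

lemma subring_adjoin: "is_subring A \<Longrightarrow> is_subring {poly g r | g. g \<in> polys_over A}"
proof -
  assume A: "is_subring A"
  note P = subring_polys_over[OF A]
  define D where "D = {poly g r | g. g \<in> polys_over A}"
  have I: "poly g r \<in> D" if "g \<in> polys_over A" for g using that unfolding D_def by blast
  have E: "\<exists>g \<in> polys_over A. x = poly g r" if "x \<in> D" for x using that unfolding D_def by blast
  have "is_subring D"
    unfolding is_subring_def
  proof (intro conjI ballI)
    show "1 \<in> D" using I[OF subring_one[OF P]] by simp
    show "- x \<in> D" if "x \<in> D" for x
      using E[OF that] I[OF subring_uminus[OF P]] by auto
    show "x + y \<in> D" if "x \<in> D" "y \<in> D" for x y
      using E[OF that(1)] E[OF that(2)] I[OF subring_add[OF P]] by auto
    show "x * y \<in> D" if "x \<in> D" "y \<in> D" for x y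
      using E[OF that(1)] E[OF that(2)] I[OF subring_mult[OF P]] by auto
  qed
  then show ?thesis unfolding D_def .
qed

lemma (in valuation_subring) poly_diff_M:
  "p \<in> polys_over V \<Longrightarrow> t \<in> V \<Longrightarrow> r \<in> V \<Longrightarrow> t - r \<in> M \<Longrightarrow> poly p t - poly p r \<in> M"
proof (induction p)
  case (pCons a p)
  then have p: "p \<in> polys_over V" by (simp add: polys_over_pCons)
  have "(t - r) * poly p t + (poly p t - poly p r) * r \<in> M"
    using pCons p subring_poly[OF subring p] by (intro M_add M_mult) auto
  then show ?case by (simp add: algebra_simps)
qed (simp add: M_zero)

text \<open>
  One of the factors of \<open>p(t)\<close> lies in the maximal ideal, because the complement of the maximal ideal
  is closed under multiplication even for elements outside \<open>V\<close>.
\<close>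

lemma (in closed_valuation_subring) root_near:
  "poly.coeff p (Polynomial.degree p) \<notin> M \<Longrightarrow> poly p t \<in> M \<Longrightarrow> \<exists>r. poly p r = 0 \<and> t - r \<in> M"
proof (induction "Polynomial.degree p" arbitrary: p)
  case 0
  then obtain c where "p = [:c:]" by (metis degree_eq_zeroE)
  then show ?case using 0 by simp
next
  case (Suc n)
  obtain r where r: "poly p r = 0" using poly_root[of p] Suc(2) by auto
  then obtain q where q: "p = [:- r, 1:] * q" by (auto simp: poly_eq_0_iff_dvd)
  have q0: "q \<noteq> 0" using Suc q by auto
  have deg: "Polynomial.degree p = Suc (Polynomial.degree q)"
    unfolding q by (subst degree_mult_eq) (use q0 in auto)
  have lead: "poly.coeff p (Polynomial.degree p) = poly.coeff q (Polynomial.degree q)"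
    unfolding deg unfolding q by (simp add: coeff_eq_0)
  have "(t - r) * poly q t \<in> M" using Suc(4) by (simp add: q algebra_simps)
  then consider "t - r \<in> M" | "poly q t \<in> M" using M_prime by blast
  then show ?case
  proof cases
    case 2
    then obtain s where "poly q s = 0" "t - s \<in> M"
      using Suc(1)[of q] Suc(2,3) deg lead by auto
    then show ?thesis by (intro exI[of _ s]) (simp add: q)
  qed (use r in blast)
qed

text \<open>
  Take a maximal subring \<open>C\<close> of \<open>V\<close> that meets the maximal ideal trivially.  If \<open>t\<close> had no
  representative, take a polynomial \<open>p\<close> over \<open>C\<close> of least degree that vanishes at \<open>t\<close> modulo the
  maximal ideal, and a true root \<open>r\<close> of \<open>p\<close> congruent to \<open>t\<close>.  By minimality \<open>C[r]\<close> still meets the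
  maximal ideal trivially, so \<open>r \<in> C\<close> represents \<open>t\<close>.
\<close>

theorem (in closed_valuation_subring) representatives_exist:
  assumes C0: "is_subring C0" "C0 \<subseteq> V" "\<And>c. c \<in> C0 \<Longrightarrow> c \<in> M \<Longrightarrow> c = 0"
    and alg: "\<And>t. t \<in> V \<Longrightarrow> \<exists>p \<in> polys_over C0. p \<noteq> 0 \<and> poly p t \<in> M"
  obtains C where "C0 \<subseteq> C" "valuation_subring_with_representatives V C"
proof -
  let ?F = "{C. C0 \<subseteq> C \<and> is_subring C \<and> C \<subseteq> V \<and> C \<inter> M \<subseteq> {0}}"
  have "\<Union>\<C> \<in> ?F" if ch: "\<C> \<noteq> {}" "subset.chain ?F \<C>" for \<C>
  proof -
    have sub: "\<C> \<subseteq> ?F" using ch(2) unfolding subset.chain_def by simp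
    have lin: "A \<subseteq> B \<or> B \<subseteq> A" if "A \<in> \<C>" "B \<in> \<C>" for A B
      using that ch(2) unfolding subset_chain_def by simp
    have F: "C0 \<subseteq> A" "is_subring A" "A \<subseteq> V" "A \<inter> M \<subseteq> {0}" if "A \<in> \<C>" for A
      using subsetD[OF sub that] by simp_all
    have two: "\<exists>A\<in>\<C>. x \<in> A \<and> y \<in> A" if xy: "x \<in> \<Union>\<C>" "y \<in> \<Union>\<C>" for x y
    proof -
      obtain A B where "A \<in> \<C>" "x \<in> A" "B \<in> \<C>" "y \<in> B" using xy by blast
      then show ?thesis using lin[of A B] by blast
    qed
    have "is_subring (\<Union>\<C>)"
      unfolding is_subring_def
    proof (intro conjI ballI)
      obtain A where "A \<in> \<C>" using ch by blast
      then show "1 \<in> \<Union>\<C>" using F[of A] subring_one[of A] by blast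
    next
      fix x assume "x \<in> \<Union>\<C>"
      then obtain A where "A \<in> \<C>" "x \<in> A" by blast
      then show "- x \<in> \<Union>\<C>" using F[of A] subring_uminus[of A x] by blast
    next
      fix x y assume "x \<in> \<Union>\<C>" "y \<in> \<Union>\<C>"
      then obtain A where "A \<in> \<C>" "x \<in> A" "y \<in> A" using two[of x y] by blast
      then show "x + y \<in> \<Union>\<C>" "x * y \<in> \<Union>\<C>"
        using F[of A] subring_add[of A x y] subring_mult[of A x y] by blast+
    qed
    moreover obtain A where "A \<in> \<C>" using ch by blast
    then have "C0 \<subseteq> \<Union>\<C>" using F(1)[of A] by blast
    moreover have "\<Union>\<C> \<subseteq> V" using F(3) by (rule Union_least)
    moreover have "\<Union>\<C> \<inter> M \<subseteq> {0}" using F(4) by auto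
    ultimately show ?thesis by simp
  qed
  moreover have "C0 \<in> ?F" using C0 by auto
  then have "?F \<noteq> {}" by blast
  ultimately obtain C where "C \<in> ?F" and max: "\<And>D. D \<in> ?F \<Longrightarrow> C \<subseteq> D \<Longrightarrow> D = C"
    using subset_Zorn_nonempty[of ?F] by meson
  then have C: "C0 \<subseteq> C" "is_subring C" "C \<subseteq> V" "C \<inter> M \<subseteq> {0}" by auto
  note P = subring_polys_over[OF C(2)]
  have "\<exists>c\<in>C. t - c \<in> M" if t: "t \<in> V" for t
  proof -
    let ?Q = "\<lambda>n. \<exists>p \<in> polys_over C. p \<noteq> 0 \<and> poly p t \<in> M \<and> Polynomial.degree p = n"
    obtain p0 where "p0 \<in> polys_over C0" "p0 \<noteq> 0" "poly p0 t \<in> M" using alg[OF t] by blast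
    then have ex: "\<exists>n. ?Q n" using polys_over_mono[OF C(1)] by blast
    obtain p where p: "p \<in> polys_over C" "p \<noteq> 0" "poly p t \<in> M" "Polynomial.degree p = (LEAST n. ?Q n)"
      using LeastI_ex[OF ex] by blast
    have minp: "Polynomial.degree p \<le> Polynomial.degree g"
      if "g \<in> polys_over C" "g \<noteq> 0" "poly g t \<in> M" for g
      unfolding p(4) using that by (intro Least_le) blast
    define d where "d = Polynomial.lead_coeff p"
    have d: "d \<in> C" "d \<noteq> 0" using p(1,2) by (auto simp: d_def polys_over_def)
    then have "d \<notin> M" using C by blast
    then obtain r where r: "poly p r = 0" "t - r \<in> M"
      using root_near[of p t] p by (auto simp: d_def)
    have rV: "r \<in> V" using V_diff[OF t M_subset[OF r(2)]] by simp
    have triv: "poly g r = 0" if "g \<in> polys_over C" "poly g r \<in> M" for g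
      using that
    proof (induction "if g = 0 then 0 else Suc (Polynomial.degree g)" arbitrary: g rule: less_induct)
      case less
      have gV: "g \<in> polys_over V" using less(2) polys_over_mono[OF C(3)] by blast
      have gt: "poly g t \<in> M"
        using M_add[OF poly_diff_M[OF gV t rV r(2)] less(3)] by simp
      show ?case
      proof (cases "g = 0")
        case False
        have deg: "Polynomial.degree p \<le> Polynomial.degree g" using minp less(2) False gt by blast
        define c where "c = Polynomial.lead_coeff g"
        have c: "c \<in> C" using less(2) by (auto simp: c_def polys_over_def)
        define h where "h = [:d:] * g - [:c:] * [:0, 1:] ^ (Polynomial.degree g - Polynomial.degree p) * p"
        have "h \<in> polys_over C"
          unfolding h_def using c d p less(2)
          by (intro subring_diff[OF P] subring_mult[OF P] subring_power[OF P]
              polys_over_const[OF C(2)] polys_over_var[OF C(2)])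
        moreover have hr: "poly h r = poly g r * d" using r by (simp add: h_def)
        moreover have "poly h r \<in> M" unfolding hr using d C less(3) by (intro M_mult) auto
        moreover have "h = 0 \<or> Polynomial.degree h < Polynomial.degree g"
          using degree_cancel_lead[OF p(2) False deg] by (simp add: h_def c_def d_def)
        ultimately have "poly h r = 0" using less(1)[of h] False by auto
        then show ?thesis using hr d by simp
      qed simp
    qed
    define D where "D = {poly g r | g. g \<in> polys_over C}"
    have D: "is_subring D" unfolding D_def by (rule subring_adjoin[OF C(2)])
    have "poly [:c:] r \<in> D" if "c \<in> C" for c
      using polys_over_const[OF C(2) that] unfolding D_def by blast
    then have CD: "C \<subseteq> D" by auto
    have "poly [:0, 1:] r \<in> D" using polys_over_var[OF C(2)] unfolding D_def by blast
    then have rD: "r \<in> D" by simp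
    have "D \<subseteq> V" using subring_poly[OF subring _ rV] polys_over_mono[OF C(3)] by (auto simp: D_def)
    moreover have "D \<inter> M \<subseteq> {0}" using triv by (auto simp: D_def)
    ultimately have "D = C" using D CD C(1) by (intro max) auto
    then show ?thesis using rD r by blast
  qed
  then have "valuation_subring_with_representatives V C"
    by unfold_locales (use C in auto)
  then show ?thesis using that C by blast
qed

section \<open>Lowest monomials\<close>

context valuation_subring begin

lemma lowest_power:
  assumes C: "is_subring C" "C \<subseteq> V"
  shows "p \<in> polys_over C \<Longrightarrow> p \<noteq> 0 \<Longrightarrow>
    \<exists>b. \<exists>c\<in>C. c \<noteq> 0 \<and> (\<forall>y\<in>M. \<exists>m\<in>M. poly p y = y ^ b * (c + m))"
proof (induction p)
  case (pCons a p)
  have ap: "a \<in> C" "p \<in> polys_over C" using pCons by (auto simp: polys_over_pCons)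
  have pV: "p \<in> polys_over V" using ap polys_over_mono[OF C(2)] by blast
  show ?case
  proof (cases "a = 0")
    case False
    have "\<exists>m\<in>M. poly (pCons a p) y = y ^ 0 * (a + m)" if "y \<in> M" for y
      using M_mult[OF that subring_poly[OF subring pV M_subset[OF that]]] by auto
    then show ?thesis using ap False by blast
  next
    case True
    then obtain b c where c: "c \<in> C" "c \<noteq> 0" "\<forall>y\<in>M. \<exists>m\<in>M. poly p y = y ^ b * (c + m)"
      using pCons ap by auto
    have "\<exists>m\<in>M. poly (pCons a p) y = y ^ Suc b * (c + m)" if "y \<in> M" for y
      using c(3) that True by (auto simp: mult.assoc)
    then show ?thesis using c by blast
  qed
qed simp

text \<open>
  The exponents and the coefficient do not depend on \<open>x\<close> and \<open>y\<close>, which allows to compare the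
  values at \<open>x\<close> and at \<open>- x\<close>.  For a lexicographic order \<open>x\<close> has to be infinitely small compared with \<open>y\<close>.
\<close>

lemma lowest_monomial:
  assumes C: "is_subring C" "C \<subseteq> V"
  shows "P \<in> polys_over (polys_over C) \<Longrightarrow> P \<noteq> 0 \<Longrightarrow>
    \<exists>a b. \<exists>c\<in>C. c \<noteq> 0 \<and> (\<forall>x y. y \<in> M \<longrightarrow> y \<noteq> 0 \<longrightarrow> (\<forall>n. x / y ^ n \<in> M) \<longrightarrow>
       (\<exists>m\<in>M. poly (poly P [:x:]) y = x ^ a * y ^ b * (c + m)))"
proof (induction P)
  case (pCons p P)
  have pP: "p \<in> polys_over C" "P \<in> polys_over (polys_over C)" using pCons by (auto simp: polys_over_pCons)
  have PV: "P \<in> polys_over (polys_over V)"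
    using pP polys_over_mono[OF polys_over_mono[OF C(2)]] by blast
  have inV: "poly (poly P [:x:]) y \<in> V" if "x \<in> V" "y \<in> V" for x y
    using that PV by (intro subring_poly subring subring_polys_over polys_over_const)
  show ?case
  proof (cases "p = 0")
    case False
    obtain b c where c: "c \<in> C" "c \<noteq> 0" "\<And>y. y \<in> M \<Longrightarrow> \<exists>m\<in>M. poly p y = y ^ b * (c + m)"
      using lowest_power[OF C pP(1) False] by blast
    have "\<exists>m\<in>M. poly (poly (pCons p P) [:x:]) y = x ^ 0 * y ^ b * (c + m)"
      if y: "y \<in> M" "y \<noteq> 0" and x: "\<forall>n. x / y ^ n \<in> M" for x y
    proof -
      obtain m where m: "m \<in> M" "poly p y = y ^ b * (c + m)" using c(3)[OF y(1)] by blast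
      have xV: "x \<in> V" using x[rule_format, of 0] M_subset by simp
      have "m + x / y ^ b * poly (poly P [:x:]) y \<in> M"
        using m x inV[OF xV M_subset[OF y(1)]] by (intro M_add M_mult) auto
      moreover have "poly (poly (pCons p P) [:x:]) y
          = x ^ 0 * y ^ b * (c + (m + x / y ^ b * poly (poly P [:x:]) y))"
        using m y by (simp add: field_simps)
      ultimately show ?thesis by blast
    qed
    then show ?thesis using c by blast
  next
    case True
    then obtain a b c where c: "c \<in> C" "c \<noteq> 0"
      "\<And>x y. y \<in> M \<Longrightarrow> y \<noteq> 0 \<Longrightarrow> (\<forall>n. x / y ^ n \<in> M) \<Longrightarrow>
         \<exists>m\<in>M. poly (poly P [:x:]) y = x ^ a * y ^ b * (c + m)"
      using pCons pP by auto
    have "\<exists>m\<in>M. poly (poly (pCons p P) [:x:]) y = x ^ Suc a * y ^ b * (c + m)"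
      if y: "y \<in> M" "y \<noteq> 0" and x: "\<forall>n. x / y ^ n \<in> M" for x y
      using c(3)[OF y x] True by (auto simp: mult.assoc)
    then show ?thesis using c by blast
  qed
qed simp

end

section \<open>The valuation ring of a valuation\<close>

context
  fixes v :: "'a::field \<Rightarrow> 'g::linordered_ab_group_add extended"
  assumes v: "valuation_on UNIV v"
begin

lemma val_mult: "v (x * y) = v x + v y"
  and val_add: "min (v x) (v y) \<le> v (x + y)"
  and val_eq_Pinf: "v x = Pinf \<longleftrightarrow> x = 0"
  and val_Minf: "v x \<noteq> Minf"
  using v unfolding valuation_on_def by auto

lemma val_Fin: "x \<noteq> 0 \<Longrightarrow> \<exists>g. v x = Fin g"
  using val_eq_Pinf[of x] val_Minf[of x] by (cases "v x") auto

lemma val_zero: "v 0 = Pinf"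
  using val_eq_Pinf by simp

lemma val_one: "v 1 = Fin 0"
proof -
  obtain g where "v 1 = Fin g" using val_Fin[of 1] by auto
  then show ?thesis using val_mult[of 1 1] by simp
qed

lemma val_uminus: "v (- x) = v x"
proof -
  obtain g where g: "v (- 1) = Fin g" using val_Fin[of "- 1"] by auto
  then have "g + g = 0" using val_mult[of "- 1" "- 1"] val_one by simp
  then have "g = 0" by (simp add: double_zero)
  then show ?thesis using val_mult[of "- 1" x] g by (cases "v x") auto
qed

lemma val_inverse: "v x = Fin g \<Longrightarrow> v (inverse x) = Fin (- g)"
proof -
  assume g: "v x = Fin g"
  then have x: "x \<noteq> 0" using val_zero by auto
  then obtain h where h: "v (inverse x) = Fin h" using val_Fin[of "inverse x"] by auto
  then have "g + h = 0" using val_mult[of x "inverse x"] g x val_one by simp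
  then show ?thesis using h by (simp add: eq_neg_iff_add_eq_0 add.commute)
qed

lemma val_divide: "v x = Fin g \<Longrightarrow> v y = Fin h \<Longrightarrow> v (x / y) = Fin (g - h)"
  by (simp add: field_class.field_divide_inverse val_mult val_inverse)

lemma valuation_subring_nonneg: "valuation_subring {x. 0 \<le> v x}"
proof
  show "is_subring {x. 0 \<le> v x}"
    unfolding is_subring_def
  proof (intro conjI ballI)
    fix x y assume "x \<in> {x. 0 \<le> v x}" "y \<in> {x. 0 \<le> v x}"
    then have xy: "0 \<le> v x" "0 \<le> v y" by auto
    then show "x + y \<in> {x. 0 \<le> v x}"
      using order.trans[OF _ val_add, of 0 x y] by simp
    show "x * y \<in> {x. 0 \<le> v x}" using xy add_mono[of 0 "v x" 0 "v y"] by (simp add: val_mult)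
  qed (auto simp: val_one val_uminus zero_extended_def)
next
  fix x assume "x \<notin> {x. 0 \<le> v x}"
  then have x: "\<not> 0 \<le> v x" by simp
  then have "x \<noteq> 0" using val_zero by auto
  then obtain g where g: "v x = Fin g" using val_Fin by blast
  show "inverse x \<in> {x. 0 \<le> v x}"
    using x g val_inverse[OF g] by (simp add: zero_extended_def)
qed

lemma maximal_ideal_iff: "x \<in> valuation_subring.M {x. 0 \<le> v x} \<longleftrightarrow> 0 < v x"
proof -
  have M: "valuation_subring.M {x. 0 \<le> v x} = {x. 0 \<le> v x \<and> (x = 0 \<or> \<not> 0 \<le> v (inverse x))}"
    by (simp add: valuation_subring.M_def[OF valuation_subring_nonneg])
  show ?thesis
  proof (cases "x = 0")
    case False
    then obtain g where g: "v x = Fin g" using val_Fin by blast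
    then show ?thesis
      unfolding M using val_inverse[OF g] False by (auto simp: zero_extended_def)
  next
    case True
    show ?thesis unfolding M True by (simp add: val_zero zero_extended_def)
  qed
qed

end

context
  fixes v :: "'a::field \<Rightarrow> (rat \<times> rat) extended"
  assumes v: "valuation_on UNIV v"
begin

lemma val_power: "v x = Fin (a, b) \<Longrightarrow> v (x ^ n) = Fin (of_nat n * a, of_nat n * b)"
  by (induction n)
     (auto simp: val_one[OF v] val_mult[OF v] algebra_simps zero_prod_def)

lemma val_power_int: "v x = Fin (a, b) \<Longrightarrow> v (x powi k) = Fin (of_int k * a, of_int k * b)"
  using val_power[of x a b "nat k"] val_power[of "inverse x" "- a" "- b" "nat (- k)"]
    val_inverse[OF v, of x "(a, b)"]
  by (auto simp: power_int_def)

end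

lemma common_denominator:
  fixes r s :: rat
  shows "\<exists>n p q. n > 0 \<and> of_nat n * r = of_int p \<and> of_nat n * s = of_int q"
proof -
  obtain p q where r: "r = of_int p / of_int q" "q > 0"
    using quotient_of_div quotient_of_denom_pos by (metis surj_pair)
  obtain p' q' where s: "s = of_int p' / of_int q'" "q' > 0"
    using quotient_of_div quotient_of_denom_pos by (metis surj_pair)
  have "of_nat (nat (q * q')) * r = of_int (p * q')" "of_nat (nat (q * q')) * s = of_int (p' * q)"
    using r s by simp_all
  moreover have "nat (q * q') > 0" using r s by simp
  ultimately show ?thesis by blast
qed

section \<open>The ambient field and its henselian subfields\<close>

lemma ambient_simps:
  "carrier \<Omega> = UNIV" "x \<otimes>\<^bsub>\<Omega>\<^esub> y = x * y" "x \<oplus>\<^bsub>\<Omega>\<^esub> y = x + y" "\<one>\<^bsub>\<Omega>\<^esub> = 1" "\<zero>\<^bsub>\<Omega>\<^esub> = 0"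
  by (simp_all add: ring_of_type_algebra_def)

lemma field_ambient: "Ring.field (\<Omega> :: 'a::field ring)"
  by (rule field_from_type_algebra)

lemma ambient_a_inv: "\<ominus>\<^bsub>\<Omega>\<^esub> x = - (x :: 'a::field)"
proof -
  interpret Ring.field "\<Omega> :: 'a ring" by (rule field_ambient)
  show ?thesis by (rule minus_equality) (auto simp: ambient_simps)
qed

lemma ambient_m_inv: "x \<noteq> 0 \<Longrightarrow> inv\<^bsub>\<Omega>\<^esub> x = inverse (x :: 'a::field)"
proof -
  assume x: "x \<noteq> 0"
  interpret Ring.field "\<Omega> :: 'a ring" by (rule field_ambient)
  show ?thesis by (rule comm_inv_char) (use x in \<open>auto simp: ambient_simps\<close>)
qed

lemma ambient_pow: "x [^]\<^bsub>\<Omega>\<^esub> (n::nat) = (x :: 'a::field) ^ n"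
proof -
  interpret Ring.field "\<Omega> :: 'a ring" by (rule field_ambient)
  show ?thesis by (induction n) (auto simp: ambient_simps mult.commute)
qed

lemma ambient_eval: "ring.eval \<Omega> xs (x :: 'a::field) = poly (Poly (rev xs)) x"
proof -
  interpret Ring.field "\<Omega> :: 'a ring" by (rule field_ambient)
  show ?thesis
    by (induction xs) (auto simp: ambient_simps ambient_pow Poly_append poly_monom mult.commute add.commute)
qed

lemma algebraic_in_ambient:
  fixes p :: "'a::alg_closed_field poly"
  assumes "p \<noteq> 0" "p \<in> polys_over F" "poly p x = 0"
  shows "x \<in> alg_closure_in_ambient F"
proof -
  interpret Ring.field "\<Omega> :: 'a ring" by (rule field_ambient)
  define xs where "xs = rev (Polynomial.coeffs p)"
  have "set xs \<subseteq> F" using assms(2) by (auto simp: xs_def polys_over_def coeffs_def)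
  moreover have ne: "xs \<noteq> []" using assms(1) by (simp add: xs_def)
  moreover have "hd xs \<noteq> 0" using assms(1) by (simp add: xs_def hd_rev last_coeffs_eq_coeff_degree)
  ultimately have "xs \<in> carrier (univ_poly \<Omega> F)" "[] \<in> carrier (univ_poly \<Omega> F)"
    by (auto simp: univ_poly_def polynomial_def ambient_simps)
  moreover have "eval xs x = eval [] x"
    using assms(3) ambient_eval[of xs x] by (simp add: xs_def ambient_simps)
  ultimately have "\<not> transcendental F x"
    using ne unfolding transcendental_def inj_on_def by blast
  then show ?thesis by (simp add: alg_closure_in_ambient_def)
qed

lemma generate_field_fixed:
  fixes R :: "('a::field \<times> 'a) set"
  assumes R: "field_graph R" and H: "\<And>h. h \<in> H \<Longrightarrow> (h, h) \<in> R" and w: "w \<in> generate_field \<Omega> H"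
  shows "(w, w) \<in> R"
  using w
proof (induction rule: generate_field.induct)
  case (m_inv h)
  then show ?case using field_graph_inverse[OF R m_inv(3)] by (simp add: ambient_simps ambient_m_inv)
qed (use H ring_graphD[OF field_graph_ring[OF R]] in \<open>auto simp: ambient_simps ambient_a_inv\<close>)

lemma subfield_generate: "subfield (generate_field \<Omega> H) (\<Omega> :: 'a::field ring)"
  using field.generate_field_is_subfield[OF field_ambient] by (simp add: ambient_simps)

text \<open>
  Two valuations of the whole field that agree with \<open>v\<close> on \<open>E\<close> agree with \<open>v\<close> on \<open>K\<close>.
\<close>

lemma henselian_algebraic_extension:
  fixes v :: "'a::alg_closed_field \<Rightarrow> 'g::divisible_linordered_ab_group_add extended"
  assumes K: "henselian K v" "alg_closure_in_ambient K = UNIV"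
    and E: "subfield E \<Omega>" "K \<subseteq> E" "alg_closure_in_ambient E = UNIV" and v: "valuation_on UNIV v"
  shows "henselian E v"
proof -
  obtain w where w: "\<forall>w'. valuation_on UNIV w' \<and> (\<forall>x\<in>K. w' x = v x) \<longrightarrow> (\<forall>x\<in>UNIV. w' x = w x)"
    using K(1) unfolding henselian_def K(2) by (elim conjE exE) (rule that)
  have vw: "v x = w x" for x using w[THEN spec, of v] v by simp
  have "\<forall>w'. valuation_on UNIV w' \<and> (\<forall>x\<in>E. w' x = v x) \<longrightarrow> (\<forall>x\<in>UNIV. w' x = v x)"
  proof (intro allI impI)
    fix w' assume w': "valuation_on UNIV w' \<and> (\<forall>x\<in>E. w' x = v x)"
    then have "\<forall>x\<in>K. w' x = v x" using E(2) by blast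
    then show "\<forall>x\<in>UNIV. w' x = v x" unfolding vw using w[THEN spec, of w'] w' vw by simp
  qed
  moreover have "valuation_on E v" using v unfolding valuation_on_def by blast
  moreover have "\<forall>x\<in>E. v x = v x" by simp
  ultimately show ?thesis unfolding henselian_def E(3) using E(1) v by blast
qed

text \<open>
  The algebraically closed field itself is henselian, so the universal property provides only one
  embedding of \<open>K\<close> into it.  The inclusion and the restriction of the given isomorphism are both
  such embeddings.
\<close>

lemma henselization_fixed:
  fixes v :: "'a::alg_closed_field \<Rightarrow> 'g::divisible_linordered_ab_group_add extended"
  assumes K: "is_henselization F v K" and v: "valuation_on UNIV v"
    and S: "field_graph S" "\<And>a. \<exists>b. (a, b) \<in> S" "\<And>a b. (a, b) \<in> S \<Longrightarrow> v b = v a"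
    and F: "\<And>f. f \<in> F \<Longrightarrow> (f, f) \<in> S" and w: "w \<in> K"
  shows "(w, w) \<in> S"
proof -
  interpret Ring.field "\<Omega> :: 'a ring" by (rule field_ambient)
  define \<sigma> where "\<sigma> a = (SOME b. (a, b) \<in> S)" for a
  have \<sigma>: "(a, \<sigma> a) \<in> S" for a using someI_ex[OF S(2)] by (simp add: \<sigma>_def)
  have \<sigma>I: "\<sigma> a = b" if "(a, b) \<in> S" for a b
    using field_graph_unique_right[OF S(1) \<sigma> that] .
  note G = ring_graphD[OF field_graph_ring[OF S(1)]]
  have U: "henselian UNIV v"
  proof -
    have "alg_closure_in_ambient (UNIV :: 'a set) = UNIV"
      using algebraic_in_ambient[of "[:- x, 1:]" UNIV x for x :: 'a] by (auto simp: polys_over_def)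
    then show ?thesis
      using v carrier_is_subfield unfolding henselian_def by (auto simp: ambient_simps)
  qed
  have id_hom: "(\<lambda>x. x) \<in> ring_hom (\<Omega>\<lparr>carrier := K\<rparr>) (\<Omega>\<lparr>carrier := UNIV\<rparr>)"
    by (auto simp: ring_hom_def)
  have \<sigma>_hom: "\<sigma> \<in> ring_hom (\<Omega>\<lparr>carrier := K\<rparr>) (\<Omega>\<lparr>carrier := UNIV\<rparr>)"
    by (auto simp: ring_hom_def ambient_simps intro!: \<sigma>I G \<sigma>)
  obtain \<phi> where \<phi>: "\<And>\<psi>. \<psi> \<in> ring_hom (\<Omega>\<lparr>carrier := K\<rparr>) (\<Omega>\<lparr>carrier := UNIV\<rparr>) \<Longrightarrow>
      (\<forall>x\<in>F. \<psi> x = x) \<Longrightarrow> (\<forall>x\<in>K. v (\<psi> x) = v x) \<Longrightarrow> (\<forall>x\<in>K. \<psi> x = \<phi> x)"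
    using K[unfolded is_henselization_def, THEN conjunct2, THEN conjunct2, THEN conjunct2,
      THEN spec[of _ UNIV], THEN spec[of _ v], THEN mp] U by blast
  have "w = \<phi> w" using \<phi>[OF id_hom] w by auto
  moreover have "\<sigma> w = \<phi> w" using \<phi>[OF \<sigma>_hom] w F \<sigma>I S(3)[OF \<sigma>] by auto
  ultimately show ?thesis using \<sigma>[of w] by simp
qed

section \<open>Rational functions and the lexicographic valuation\<close>

type_synonym 'k ambient_field = "'k poly poly fract alg_closure"

definition of_poly :: "'k::field poly poly \<Rightarrow> 'k ambient_field" where
  "of_poly f = to_ac (Fract f 1)"

definition of_const :: "'k::field \<Rightarrow> 'k ambient_field" where
  "of_const c = of_poly [:[:c:]:]"

lemma of_poly_hom:
  "of_poly (f + g) = of_poly f + of_poly g" "of_poly (f * g) = of_poly f * of_poly g"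
  "of_poly 0 = 0" "of_poly 1 = 1"
  by (simp_all add: of_poly_def flip: to_ac_add to_ac_mult Zero_fract_def One_fract_def)

lemma of_const_hom:
  fixes a b :: "'k::field"
  shows
  "of_const (a + b) = of_const a + of_const b" "of_const (a * b) = of_const a * of_const b"
  "of_const (0 :: 'k) = 0" "of_const (1 :: 'k) = 1" "of_const (- a) = - of_const a"
proof -
  have add: "of_const (a + b) = of_const a + of_const b" for a b :: "'k"
    by (simp add: of_const_def flip: of_poly_hom)
  have zero: "of_const (0 :: 'k) = 0" by (simp add: of_const_def of_poly_hom)
  show "of_const (a + b) = of_const a + of_const b" by (rule add)
  show "of_const (a * b) = of_const a * of_const b"
    by (simp add: of_const_def flip: of_poly_hom)
  show "of_const (0 :: 'k) = 0" by (rule zero)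
  show "of_const (1 :: 'k) = 1"
    using of_poly_hom(4) by (simp add: of_const_def one_pCons)
  show "of_const (- a) = - of_const a"
    using add[of "- a" a] zero by (simp add: eq_neg_iff_add_eq_0)
qed

lemma of_const_eq_0_iff: "of_const a = 0 \<longleftrightarrow> a = 0"
  by (metis mult_not_zero of_const_hom(2,3,4) right_inverse zero_neq_one)

lemma subring_constants: "is_subring (range (of_const :: 'k::field \<Rightarrow> _))"
  unfolding is_subring_def
proof (intro conjI ballI)
  show "1 \<in> range (of_const :: 'k \<Rightarrow> _)" by (rule range_eqI[of _ _ 1]) (simp add: of_const_hom)
next
  fix x y :: "'k ambient_field" assume "x \<in> range of_const" "y \<in> range of_const"
  then obtain a b where "x = of_const a" "y = of_const b" by blast
  then show "- x \<in> range of_const" "x + y \<in> range of_const" "x * y \<in> range of_const"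
    by (simp_all flip: of_const_hom)
qed

lemma of_const_inverse: "inverse (of_const a) = of_const (inverse a)"
proof (cases "a = 0")
  case False
  then have "of_const a * of_const (inverse a) = 1" by (simp flip: of_const_hom)
  then show ?thesis by (rule inverse_unique)
qed (simp add: of_const_hom)

lemma of_poly_eq_poly:
  "of_poly f = poly (poly (map_poly (map_poly of_const) f) [:of_poly poly_X:]) (of_poly poly_Y)"
proof (induction f)
  case (pCons p f)
  have "of_poly [:p:] = poly (map_poly of_const p) (of_poly poly_Y)"
  proof (induction p)
    case (pCons a p)
    have "[:pCons a p:] = [:[:a:]:] + poly_Y * [:p:]" by (simp add: poly_Y_def)
    then have "of_poly [:pCons a p:] = of_const a + of_poly poly_Y * of_poly [:p:]"
      by (simp only: of_poly_hom of_const_def)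
    then show ?case using pCons by (simp add: map_poly_pCons of_const_hom)
  qed (simp add: of_poly_hom)
  moreover have "pCons p f = [:p:] + poly_X * f" by (simp add: poly_X_def)
  then have "of_poly (pCons p f) = of_poly [:p:] + of_poly poly_X * of_poly f"
    by (simp only: of_poly_hom)
  ultimately show ?case using pCons by (simp add: map_poly_pCons)
qed (simp add: of_poly_hom)

lemma map_poly_of_const_mem: "map_poly (map_poly of_const) f \<in> polys_over (polys_over (range of_const))"
  by (simp add: polys_over_def coeff_map_poly of_const_hom)

lemma map_poly_of_const_eq_0: "map_poly (map_poly of_const) f = 0 \<longleftrightarrow> f = 0"
  by (simp add: poly_eq_iff coeff_map_poly of_const_hom of_const_eq_0_iff)

lemma rational_functions_cases:
  obtains f g where "g \<noteq> 0" "to_ac r = of_poly f / of_poly g"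
proof -
  obtain f g where r: "r = Fract f g" "g \<noteq> 0" by (cases r)
  then have "r = Fract f 1 / Fract g 1" by simp
  then show ?thesis using that r(2) unfolding of_poly_def by (metis to_ac_divide)
qed

lemma alg_closure_in_ambient_UNIV:
  assumes "rational_functions \<subseteq> E"
  shows "alg_closure_in_ambient E = (UNIV :: 'k::field ambient_field set)"
proof -
  have "x \<in> alg_closure_in_ambient E" for x :: "'k ambient_field"
  proof -
    obtain p where p: "p \<noteq> 0" "poly (map_poly to_ac p) x = 0" using alg_closure_algebraic .
    have "map_poly to_ac p \<noteq> 0" using p(1) by (simp add: poly_eq_iff coeff_map_poly)
    moreover have "map_poly to_ac p \<in> polys_over E"
      using assms by (auto simp: polys_over_def coeff_map_poly)
    ultimately show ?thesis using p(2) algebraic_in_ambient by blast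
  qed
  then show ?thesis by auto
qed

lemma lex_val_monom: "c \<noteq> 0 \<Longrightarrow> lex_val (Polynomial.monom (Polynomial.monom c j) i) = Fin (int i, int j)"
proof -
  assume c: "c \<noteq> 0"
  then have "{(int a, int b) | a b. poly.coeff (poly.coeff (Polynomial.monom (Polynomial.monom c j) i) a) b \<noteq> 0}
    = {(int i, int j)}"
    by auto
  then show ?thesis using c by (simp add: lex_val_def)
qed

lemma extends_lex_val_monom:
  assumes "extends_lex_val v" "c \<noteq> 0"
  shows "v (of_poly (Polynomial.monom (Polynomial.monom c j) i)) = Fin (of_nat i, of_nat j)"
proof -
  have "lex_val (1 :: 'a poly poly) = Fin (0, 0)"
    using lex_val_monom[of "1 :: 'a" 0 0] by (simp add: monom_0 one_pCons)
  then show ?thesis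
    using assms(1)[unfolded extends_lex_val_def, rule_format, of 1 "Polynomial.monom (Polynomial.monom c j) i"]
    by (simp add: lex_val_monom[OF assms(2)] lex_embed_def of_poly_def)
qed

locale lex_valuation =
  fixes v :: "'k::field ambient_field \<Rightarrow> (rat \<times> rat) extended"
  assumes v: "valuation_on UNIV v" and lex: "extends_lex_val v"
begin

definition V :: "'k ambient_field set" where "V = {x. 0 \<le> v x}"

sublocale closed_valuation_subring V
  unfolding closed_valuation_subring_def V_def by (rule valuation_subring_nonneg[OF v])

lemma V_iff: "x \<in> V \<longleftrightarrow> 0 \<le> v x"
  by (simp add: V_def)

lemma M_iff: "x \<in> M \<longleftrightarrow> 0 < v x"
  using maximal_ideal_iff[OF v] by (simp add: V_def)

abbreviation genX :: "'k ambient_field" where "genX \<equiv> of_poly poly_X"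
abbreviation genY :: "'k ambient_field" where "genY \<equiv> of_poly poly_Y"

lemma val_X: "v genX = Fin (1, 0)"
  using extends_lex_val_monom[OF lex, of 1 0 1] by (simp add: poly_X_def monom_altdef one_pCons)

lemma val_Y: "v genY = Fin (0, 1)"
  using extends_lex_val_monom[OF lex, of 1 1 0] by (simp add: poly_Y_def monom_altdef)

lemma val_const: "c \<noteq> 0 \<Longrightarrow> v (of_const c) = Fin (0, 0)"
  using extends_lex_val_monom[OF lex, of c 0 0] by (simp add: of_const_def monom_0)

lemma constants_subset: "range (of_const :: 'k \<Rightarrow> _) \<subseteq> V"
proof
  fix x assume "x \<in> range (of_const :: 'k \<Rightarrow> _)"
  then obtain c :: 'k where "x = of_const c" by blast
  then show "x \<in> V"
    using val_const[of c] V_zero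
    by (cases "c = 0") (auto simp: of_const_hom V_iff zero_extended_def zero_prod_def)
qed

lemma constant_M: "of_const c \<in> M \<Longrightarrow> of_const c = 0"
  using val_const[of c] by (cases "c = 0") (auto simp: M_iff zero_extended_def zero_prod_def of_const_hom)

lemma lex_small:
  assumes "v x = Fin (\<alpha>, 0)" "v y = Fin (0, \<beta>)" "0 < \<alpha>" "0 < \<beta>"
  shows "y \<in> M" "y \<noteq> 0" "x / y ^ n \<in> M"
proof -
  show "y \<in> M" using assms by (simp add: M_iff zero_extended_def zero_prod_def less_prod_def)
  show "y \<noteq> 0" using assms val_zero[OF v] by auto
  show "x / y ^ n \<in> M"
    using val_divide[OF v assms(1) val_power[OF v assms(2)]] assms(3)
    by (simp add: M_iff zero_extended_def zero_prod_def less_prod_def)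
qed

lemma lowest_monomial_of_poly:
  assumes "f \<noteq> 0"
  shows "\<exists>a b c. c \<noteq> 0 \<and> (\<exists>m\<in>M. of_poly f = genX ^ a * genY ^ b * (of_const c + m))"
proof -
  obtain a b c where c: "c \<in> range of_const" "c \<noteq> 0" "\<And>x y. y \<in> M \<Longrightarrow> y \<noteq> 0 \<Longrightarrow> (\<forall>n. x / y ^ n \<in> M) \<Longrightarrow>
       (\<exists>m\<in>M. poly (poly (map_poly (map_poly of_const) f) [:x:]) y = x ^ a * y ^ b * (c + m))"
    using lowest_monomial[OF subring_constants constants_subset map_poly_of_const_mem, of f] assms
    unfolding map_poly_of_const_eq_0 by blast
  obtain d where d: "c = of_const d" using c(1) by blast
  have "\<exists>m\<in>M. of_poly f = genX ^ a * genY ^ b * (of_const d + m)"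
    using c(3)[of genY genX] lex_small[OF val_X val_Y] by (simp add: d of_poly_eq_poly[symmetric])
  moreover have "d \<noteq> 0" using c(2) d by (auto simp: of_const_hom)
  ultimately show ?thesis by blast
qed

lemma const_plus_M_unit: "c \<noteq> 0 \<Longrightarrow> m \<in> M \<Longrightarrow> of_const c + m \<in> V \<and> of_const c + m \<notin> M"
  using unit_plus_M[of "of_const c" m] constants_subset constant_M[of c] by (auto simp: of_const_eq_0_iff)

lemma val_unit_iff: "x \<in> V \<and> x \<notin> M \<longleftrightarrow> v x = Fin 0"
  unfolding M_iff V_iff zero_extended_def by auto

text \<open>
  In a quotient of value \<open>0\<close> the lowest monomials of numerator and denominator are equal, and the
  residue is the quotient of their coefficients.
\<close>

lemma residue_of_rational_function:
  assumes w: "to_ac r \<in> V"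
  shows "\<exists>c. to_ac r - of_const c \<in> M"
proof (cases "to_ac r \<in> M")
  case True
  then show ?thesis by (intro exI[of _ 0]) (simp add: of_const_hom)
next
  case False
  obtain f g where fg: "g \<noteq> 0" "to_ac r = of_poly f / of_poly g" by (rule rational_functions_cases)
  have "f \<noteq> 0" using False fg M_zero by (auto simp: of_poly_hom)
  then obtain a b c m where f: "c \<noteq> 0" "m \<in> M" "of_poly f = genX ^ a * genY ^ b * (of_const c + m)"
    using lowest_monomial_of_poly by blast
  obtain a' b' d n where g: "d \<noteq> 0" "n \<in> M" "of_poly g = genX ^ a' * genY ^ b' * (of_const d + n)"
    using lowest_monomial_of_poly[OF fg(1)] by blast
  have mon: "v (genX ^ i * genY ^ j * u) = Fin (of_nat i, of_nat j)" if "v u = Fin 0" for i j u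
    using val_power[OF v val_X, of i] val_power[OF v val_Y, of j] that by (simp add: val_mult[OF v])
  have uf: "v (of_const c + m) = Fin 0" and ug: "v (of_const d + n) = Fin 0"
    using const_plus_M_unit f g unfolding val_unit_iff by blast+
  have "v (to_ac r) = Fin (of_nat a - of_nat a', of_nat b - of_nat b')"
    unfolding fg(2) using val_divide[OF v mon[OF uf, of a b] mon[OF ug, of a' b']] by (simp add: f(3) g(3))
  then have ab: "a = a'" "b = b'" using val_unit_iff[of "to_ac r"] w False by (auto simp: zero_prod_def)
  have nz: "of_const d + n \<noteq> 0" "genX \<noteq> 0" "genY \<noteq> 0" "of_const d \<noteq> 0"
    using ug val_X val_Y val_zero[OF v] g(1) by (auto simp: of_const_eq_0_iff)
  have iV: "inverse (of_const d + n) \<in> V" "inverse (of_const d) \<in> V"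
    using const_plus_M_unit[OF g(1,2)] unit_inverse constants_subset by (auto simp: of_const_inverse)
  have cV: "of_const c \<in> V" using constants_subset by auto
  have "(m - n * (of_const c * inverse (of_const d))) * inverse (of_const d + n) \<in> M"
    using f(2) g(2) iV cV by (intro M_mult M_diff V_mult) auto
  moreover have "(m - n * (of_const c * inverse (of_const d))) * inverse (of_const d + n)
      = to_ac r - of_const (c * inverse d)"
  proof -
    define D where "D = of_const d + n"
    define q where "q = of_const c * inverse (of_const d)"
    have D: "D \<noteq> 0" and c: "of_const c = q * of_const d" using nz by (auto simp: D_def q_def)
    have "to_ac r = (of_const c + m) / D"
      unfolding fg(2) f(3) g(3) ab D_def using nz by simp
    moreover have "(of_const c + m) / D - q = (of_const c + m - q * D) / D"
      using D by (simp add: diff_divide_distrib)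
    moreover have "of_const c + m - q * D = m - n * q"
      unfolding c D_def by (simp add: algebra_simps)
    ultimately show ?thesis
      unfolding of_const_hom(2) of_const_inverse[symmetric]
      by (simp add: D_def q_def field_class.field_divide_inverse)
  qed
  ultimately show ?thesis by metis
qed

text \<open>
  Divide an algebraic equation of \<open>t\<close> over \<open>k(X,Y)\<close> by a coefficient of least value and pass to
  residues.
\<close>

lemma residue_algebraic:
  assumes t: "t \<in> V"
  shows "\<exists>p \<in> polys_over (range of_const). p \<noteq> 0 \<and> poly p t \<in> M"
proof -
  obtain q :: "'k poly poly fract poly" where q: "q \<noteq> 0" "poly (map_poly to_ac q) t = 0"
    using alg_closure_algebraic .
  define I where "I = {i. i \<le> Polynomial.degree q \<and> poly.coeff q i \<noteq> 0}"
  have fin: "finite I" by (rule finite_subset[of _ "{..Polynomial.degree q}"]) (auto simp: I_def)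
  have ne: "I \<noteq> {}" using q(1) by (auto simp: I_def intro!: exI[of _ "Polynomial.degree q"])
  let ?w = "\<lambda>i. v (to_ac (poly.coeff q i))"
  have "Min (?w ` I) \<in> ?w ` I" using fin ne by simp
  then obtain j where j: "j \<in> I" "?w j = Min (?w ` I)" by auto
  have j_min: "?w j \<le> ?w i" if "i \<in> I" for i using j fin that by simp
  define d where "d = poly.coeff q j"
  have d0: "d \<noteq> 0" using j by (simp add: d_def I_def)
  define e where "e f = (if f = 0 then 0 else SOME c. to_ac (f / d) - of_const c \<in> M)" for f
  have V: "to_ac (poly.coeff q i / d) \<in> V" for i
  proof (cases "poly.coeff q i = 0")
    case False
    then have "i \<in> I" by (simp add: I_def le_degree)
    then have le: "v (to_ac d) \<le> v (to_ac (poly.coeff q i))" using j_min by (simp add: d_def)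
    obtain g h where gh: "v (to_ac d) = Fin g" "v (to_ac (poly.coeff q i)) = Fin h"
      using val_Fin[OF v] d0 False by (metis to_ac_eq_0_iff)
    show ?thesis using val_divide[OF v gh(2,1)] le gh by (simp add: V_def zero_extended_def)
  qed (simp add: V_zero)
  have e: "to_ac (poly.coeff q i / d) - of_const (e (poly.coeff q i)) \<in> M" for i
    using someI_ex[OF residue_of_rational_function[OF V[of i]]] by (simp add: e_def of_const_hom M_zero)
  define p where "p = map_poly (\<lambda>f. of_const (e f)) q"
  have cp: "poly.coeff p i = of_const (e (poly.coeff q i))" for i
    unfolding p_def by (rule coeff_map_poly) (simp add: e_def of_const_hom)
  define r where "r = Polynomial.smult (inverse (to_ac d)) (map_poly to_ac q) - p"
  have "poly.coeff r i \<in> M" for i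
    using e[of i] by (simp add: r_def cp coeff_map_poly field_class.field_divide_inverse mult.commute)
  then have "poly r t \<in> M" by (intro poly_M t)
  then have "poly p t \<in> M" using M_uminus[of "poly r t"] q(2) by (simp add: r_def)
  moreover have "poly.coeff p j \<noteq> 0"
  proof
    assume "poly.coeff p j = 0"
    then have "1 \<in> M" using e[of j] d0 by (simp add: cp d_def[symmetric])
    then show False using one_notin_M by simp
  qed
  then have "p \<noteq> 0" by auto
  moreover have "p \<in> polys_over (range of_const)" by (auto simp: polys_over_def cp)
  ultimately show ?thesis by blast
qed

text \<open>
  For each \<open>a \<noteq> 0\<close> some power \<open>a ^ n\<close> has the value of a monomial \<open>m\<close> in \<open>X\<close> and \<open>Y\<close>, and an
  isomorphism that preserves the valuation ring maps the unit \<open>a ^ n / m\<close> to a unit.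
\<close>

lemma preserves_imp_val_eq:
  assumes S: "field_graph S" "preserves S" and XY: "(genX, genX) \<in> S" "(genY, genY) \<in> S" and ab: "(a, b) \<in> S"
  shows "v b = v a"
proof (cases "a = 0")
  case True
  then show ?thesis using field_graph_zero_iff[OF S(1) ab] by simp
next
  case False
  then obtain r s where rs: "v a = Fin (r, s)" using val_Fin[OF v] by (metis surj_pair)
  have b0: "b \<noteq> 0" using False field_graph_zero_iff[OF S(1) ab] by simp
  then obtain r' s' where rs': "v b = Fin (r', s')" using val_Fin[OF v] by (metis surj_pair)
  obtain n p q where n: "n > 0" "of_nat n * r = of_int p" "of_nat n * s = of_int q"
    using common_denominator by blast
  define m where "m = genX powi p * genY powi q"
  have vm: "v m = Fin (of_int p, of_int q)"
    using val_power_int[OF v val_X, of p] val_power_int[OF v val_Y, of q] by (simp add: m_def val_mult[OF v])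
  have mS: "(m, m) \<in> S"
    unfolding m_def using XY by (intro ring_graph_mult field_graph_power_int field_graph_ring S)
  have u: "(a ^ n / m, b ^ n / m) \<in> S"
    by (intro field_graph_divide ring_graph_power field_graph_ring S ab mS)
  have va: "v (a ^ n / m) = Fin (0, 0)"
    using val_divide[OF v val_power[OF v rs] vm] n by simp
  then have "a ^ n / m \<in> V \<and> a ^ n / m \<notin> M" unfolding val_unit_iff by (simp add: zero_prod_def)
  then have "b ^ n / m \<in> V \<and> b ^ n / m \<notin> M"
    using S(2) u preserves_M[OF S u] unfolding preserves_def by blast
  then have "v (b ^ n / m) = Fin 0" unfolding val_unit_iff .
  then have "of_nat n * r' = of_int p" "of_nat n * s' = of_int q"
    using val_divide[OF v val_power[OF v rs'] vm] by (simp_all add: zero_prod_def)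
  then have "r' = r" "s' = s" using n by (metis mult_cancel_left of_nat_eq_0_iff less_irrefl)+
  then show ?thesis using rs rs' by simp
qed

end

section \<open>An automorphism that moves only one of the square roots\<close>

context lex_valuation begin

lemma val_sqrt:
  assumes "v (s ^ 2) = Fin (a, b)"
  shows "v s = Fin (a / 2, b / 2)"
proof -
  have "s \<noteq> 0" using assms val_zero[OF v] by auto
  then obtain c d where cd: "v s = Fin (c, d)" using val_Fin[OF v, of s] by auto
  have "2 * c = a" "2 * d = b" using assms val_power[OF v cd, of 2] by simp_all
  then have "c = a / 2" "d = b / 2" by simp_all
  then show ?thesis using cd by simp
qed

lemma rational_functions_in_field:
  assumes R: "field_graph R" and c: "\<And>c. (of_const c, of_const c) \<in> R"
    and XY: "(genX, genX) \<in> R" "(genY, genY) \<in> R"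
  shows "(to_ac r, to_ac r) \<in> R"
proof -
  define A where "A = {w. (w, w) \<in> R}"
  note RR = ring_graphD[OF field_graph_ring[OF R]]
  have A: "is_subring A"
    unfolding is_subring_def A_def mem_Collect_eq using RR by blast
  have C: "range of_const \<subseteq> A" using c by (auto simp: A_def)
  have "of_poly f \<in> A" for f
  proof (subst of_poly_eq_poly, intro subring_poly[OF A] subring_poly[OF subring_polys_over[OF A]] polys_over_const[OF A])
    show "map_poly (map_poly of_const) f \<in> polys_over (polys_over A)"
      using map_poly_of_const_mem polys_over_mono[OF polys_over_mono[OF C]] by blast
  qed (use XY in \<open>auto simp: A_def\<close>)
  then have of_poly: "(of_poly f, of_poly f) \<in> R" for f by (simp add: A_def)
  obtain f g where fg: "g \<noteq> 0" "to_ac r = of_poly f / of_poly g" by (rule rational_functions_cases)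
  show ?thesis unfolding fg(2) by (intro field_graph_divide[OF R] of_poly)
qed

text \<open>
  On \<open>C[s,t]\<close> the substitution of \<open>- s\<close> for \<open>s\<close> multiplies each element by a unit, since it leaves
  the lowest monomial unchanged up to sign.  So it extends to a value-preserving automorphism of
  the field of fractions and from there to the whole field.
\<close>

lemma exists_automorphism:
  assumes s: "s ^ 2 = genX" and t: "t ^ 2 = genY"
  shows "\<exists>C S. valuation_subring_with_representatives V C \<and> field_graph S \<and>
    (\<forall>a. \<exists>b. (a, b) \<in> S) \<and> (\<forall>a b. (a, b) \<in> S \<longrightarrow> v b = v a) \<and>
    (\<forall>f\<in>rational_functions. (f, f) \<in> S) \<and> (\<forall>c\<in>C. (c, c) \<in> S) \<and> (s, - s) \<in> S \<and> (t, t) \<in> S"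
proof -
  obtain C where C0: "range of_const \<subseteq> C" and C: "valuation_subring_with_representatives V C"
    by (rule representatives_exist[OF subring_constants constants_subset _ residue_algebraic])
       (use constant_M in auto)
  interpret valuation_subring_with_representatives V C by (rule C)
  note P = subring_polys_over[OF subring_polys_over[OF C_subring]]
  define E where "E = (\<lambda>P x. poly (poly P [:x:]) t)"
  define R0 where "R0 = {(E P s, E P (- s)) | P. P \<in> polys_over (polys_over C)}"
  have I: "(E P s, E P (- s)) \<in> R0" if "P \<in> polys_over (polys_over C)" for P
    using that unfolding R0_def by blast
  have hom: "E 1 x = 1" "E (- P) x = - E P x" "E (P + Q) x = E P x + E Q x" "E (P * Q) x = E P x * E Q x" for P Q x
    by (simp_all add: E_def)
  have D: "\<exists>P \<in> polys_over (polys_over C). a = E P s \<and> a' = E P (- s)" if "(a, a') \<in> R0" for a a'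
    using that unfolding R0_def by blast
  have R0: "ring_graph R0"
    unfolding ring_graph_def
  proof (intro conjI allI impI)
    show "(1, 1) \<in> R0" using I[OF subring_one[OF P]] by (simp add: hom)
  next
    fix a a' assume "(a, a') \<in> R0"
    then show "(- a, - a') \<in> R0" using D[of a a'] I[OF subring_uminus[OF P]] by (auto simp: hom)
  next
    fix a a' b b' assume "(a, a') \<in> R0" "(b, b') \<in> R0"
    then obtain p q where "p \<in> polys_over (polys_over C)" "q \<in> polys_over (polys_over C)"
      "a = E p s" "a' = E p (- s)" "b = E q s" "b' = E q (- s)"
      using D[of a a'] D[of b b'] by blast
    then show "(a + b, a' + b') \<in> R0" "(a * b, a' * b') \<in> R0"
      using I[OF subring_add[OF P]] I[OF subring_mult[OF P]] by (auto simp: hom)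
  qed
  have vs: "v s = Fin (1 / 2, 0)" using val_sqrt[of s 1 0] s val_X by simp
  have vt: "v t = Fin (0, 1 / 2)" using val_sqrt[of t 0 1] t val_Y by simp
  have vs': "v (- s) = Fin (1 / 2, 0)" using vs val_uminus[OF v] by simp
  have s0: "s \<noteq> 0" using vs val_zero[OF v] by auto
  have unit: "\<exists>u. u \<in> V \<and> u \<notin> M \<and> a' = u * a" if "(a, a') \<in> R0" for a a'
  proof -
    obtain p where p: "p \<in> polys_over (polys_over C)" "a = E p s" "a' = E p (- s)" using D[OF \<open>(a, a') \<in> R0\<close>] by blast
    show ?thesis
    proof (cases "p = 0")
      case True
      then show ?thesis using p V_one one_notin_M by (intro exI[of _ 1]) (simp add: E_def)
    next
      case False
      obtain i j c where c: "c \<in> C" "c \<noteq> 0"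
        "\<And>x y. y \<in> M \<Longrightarrow> y \<noteq> 0 \<Longrightarrow> (\<forall>n. x / y ^ n \<in> M) \<Longrightarrow>
           (\<exists>m\<in>M. poly (poly p [:x:]) y = x ^ i * y ^ j * (c + m))"
        using lowest_monomial[OF C_subring C_subset p(1) False] by blast
      obtain m where m: "m \<in> M" "a = s ^ i * t ^ j * (c + m)"
        using c(3)[of t s] lex_small[OF vs vt] p by (auto simp: E_def)
      obtain n where n: "n \<in> M" "a' = (- s) ^ i * t ^ j * (c + n)"
        using c(3)[of t "- s"] lex_small[OF vs' vt] p by (auto simp: E_def)
      have cV: "c \<in> V" "c \<notin> M" using c C_subset C_M by auto
      have u: "v (c + m) = Fin 0" "v (c + n) = Fin 0"
        using unit_plus_M[OF cV] m n unfolding val_unit_iff[symmetric] by auto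
      define q where "q = (c + n) / (c + m)"
      define u where "u = (- 1) ^ i * q"
      have "v u = v q"
        unfolding u_def by (cases "even i") (simp_all add: val_uminus[OF v])
      then have "v u = Fin 0" using val_divide[OF v u(2,1)] by (simp add: q_def)
      moreover have "c + m \<noteq> 0" using u val_zero[OF v] by auto
      then have "a' = u * a" using power_minus[of s i] by (simp add: m(2) n(2) u_def q_def)
      ultimately show ?thesis using val_unit_iff[of u] by blast
    qed
  qed
  have zero: "a = 0 \<longleftrightarrow> a' = 0" if "(a, a') \<in> R0" for a a'
    using unit[OF that] M_zero by auto
  define R where "R = {(a / b, a' / b') | a a' b b'. (a, a') \<in> R0 \<and> (b, b') \<in> R0 \<and> b \<noteq> 0}"
  have R: "field_graph R" unfolding R_def by (rule field_graph_fractions[OF R0 zero])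
  have unit_mult: "u * a \<in> V \<longleftrightarrow> a \<in> V" if "u \<in> V" "u \<notin> M" for u a
  proof -
    have "u \<noteq> 0" using that M_zero by auto
    then have e: "inverse u * (u * a) = a" by (simp add: mult.assoc[symmetric])
    show ?thesis
      using V_mult[OF that(1), of a] V_mult[OF unit_inverse[OF that], of "u * a"] unfolding e by blast
  qed
  have pres: "preserves R"
    unfolding preserves_def
  proof (intro allI impI)
    fix w w' assume "(w, w') \<in> R"
    then obtain a a' b b' where h: "(a, a') \<in> R0" "(b, b') \<in> R0" "w = a / b" "w' = a' / b'"
      unfolding R_def by auto
    obtain x where x: "x \<in> V" "x \<notin> M" "a' = x * a" using unit[OF h(1)] by blast
    obtain y where y: "y \<in> V" "y \<notin> M" "b' = y * b" using unit[OF h(2)] by blast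
    have "v x = Fin 0" "v y = Fin 0" using x y by (simp_all flip: val_unit_iff)
    then have "v (x / y) = Fin 0" using val_divide[OF v] by simp
    moreover have "w' = x / y * w" using h x y by simp
    ultimately show "w \<in> V \<longleftrightarrow> w' \<in> V" using unit_mult[of "x / y" w] val_unit_iff by blast
  qed
  have "(a / b, a' / b') \<in> R" if "(a, a') \<in> R0" "(b, b') \<in> R0" "b \<noteq> 0" for a a' b b'
    using that unfolding R_def by blast
  from this[OF _ ring_graph_one[OF R0]] have R0_R: "(a, a') \<in> R" if "(a, a') \<in> R0" for a a'
    using that by simp
  have CR: "(c, c) \<in> R" if "c \<in> C" for c
    using R0_R I[OF polys_over_const[OF subring_polys_over[OF C_subring] polys_over_const[OF C_subring that]]]
    by (simp add: E_def)
  have sR: "(s, - s) \<in> R"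
    using R0_R I[OF polys_over_var[OF subring_polys_over[OF C_subring]]] by (simp add: E_def)
  have tR: "(t, t) \<in> R"
    using R0_R I[OF polys_over_const[OF subring_polys_over[OF C_subring] polys_over_var[OF C_subring]]]
    by (simp add: E_def)
  have XR: "(genX, genX) \<in> R"
    using ring_graph_power[OF field_graph_ring[OF R] sR, of 2] by (simp add: s)
  have YR: "(genY, genY) \<in> R"
    using ring_graph_power[OF field_graph_ring[OF R] tR, of 2] by (simp add: t)
  have FR: "(to_ac r, to_ac r) \<in> R" for r
    using CR C0 by (intro rational_functions_in_field R XR YR) auto
  have alg: "algebraic_over R"
    unfolding algebraic_over_def
  proof
    fix a :: "'k ambient_field"
    obtain q :: "'k poly poly fract poly" where q: "q \<noteq> 0" "poly (map_poly to_ac q) a = 0"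
      using alg_closure_algebraic .
    define p where "p = map_poly to_ac q"
    have cp: "poly.coeff p i = to_ac (poly.coeff q i)" for i by (simp add: p_def coeff_map_poly)
    have "p \<noteq> 0" using q(1) by (simp add: poly_eq_iff cp)
    moreover have "(poly.coeff p i, poly.coeff p i) \<in> R" for i unfolding cp by (rule FR)
    then have "(p, p) \<in> graph_over R" by (simp add: graph_over_def)
    moreover have "poly p a = 0" using q(2) by (simp add: p_def)
    ultimately show "\<exists>p q. (p, q) \<in> graph_over R \<and> p \<noteq> 0 \<and> poly p a = 0" by blast
  qed
  have CR': "Id_on C \<subseteq> R" using CR by auto
  obtain S where S: "R \<subseteq> S" "field_graph S" "preserves S" "\<forall>a. \<exists>b. (a, b) \<in> S"
    using extend_to_all[OF R pres alg CR'] by (elim exE conjE) (rule that)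
  have vS: "v b = v a" if "(a, b) \<in> S" for a b
    by (rule preserves_imp_val_eq[OF S(2,3) _ _ that]) (use S(1) XR YR in auto)
  have FS: "\<forall>f\<in>rational_functions. (f, f) \<in> S" and CS: "\<forall>c\<in>C. (c, c) \<in> S"
    using FR CR S(1) by auto
  show ?thesis
    using S(4) vS
    by (intro exI[of _ C] exI[of _ S] conjI C S(2) FS CS subsetD[OF S(1) sR] subsetD[OF S(1) tR]) auto
qed

text \<open>
  If \<open>v z = v s\<close>, the unit \<open>z / s\<close> is mapped to its negative by an isomorphism that fixes
  representatives of all residues; so twice its residue is \<open>0\<close>.
\<close>

lemma value_not_attained:
  assumes char: "CHAR('k) \<noteq> 2" and K: "is_henselization rational_functions v K"
    and s: "s ^ 2 = genX" and t: "t ^ 2 = genY" and z: "z \<in> generate_field \<Omega> (insert t K)"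
  shows "v z \<noteq> v s"
proof
  assume zs: "v z = v s"
  obtain C S where C: "valuation_subring_with_representatives V C" and S: "field_graph S"
      "\<forall>a. \<exists>b. (a, b) \<in> S" "\<forall>a b. (a, b) \<in> S \<longrightarrow> v b = v a"
      "\<forall>f\<in>rational_functions. (f, f) \<in> S" "\<forall>c\<in>C. (c, c) \<in> S" "(s, - s) \<in> S" "(t, t) \<in> S"
    using exists_automorphism[OF s t] by (elim exE conjE) (rule that)
  interpret valuation_subring_with_representatives V C by (rule C)
  have KS: "(w, w) \<in> S" if "w \<in> K" for w
    by (rule henselization_fixed[OF K v S(1) _ _ _ that]) (use S in auto)
  have "(h, h) \<in> S" if "h \<in> insert t K" for h using that S(7) KS by auto
  then have "(z, z) \<in> S" by (rule generate_field_fixed[OF S(1) _ z])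
  then have "(z / s, z / - s) \<in> S" by (intro field_graph_divide S)
  then have xS: "(z / s, - (z / s)) \<in> S" by simp
  define x where "x = z / s"
  have "v s = Fin (1 / 2, 0)" using val_sqrt[of s 1 0] s val_X by simp
  then have "v x = Fin 0" using val_divide[OF v, of z _ s] zs by (simp add: x_def)
  then have "x \<in> V" using val_unit_iff[of x] by simp
  then obtain c where c: "c \<in> C" "x - c \<in> M" using residue by blast
  have "(x - c, - x - c) \<in> S"
    using ring_graph_diff[OF field_graph_ring[OF S(1)]] xS S(5) c(1) by (simp add: x_def)
  then have "- x - c \<in> M" using c(2) S(3) by (simp add: M_iff)
  then have "(x - c) - (- x - c) \<in> M" using c(2) M_diff by blast
  then have "2 * x \<in> M" by simp
  then have "2 \<in> M \<or> x \<in> M" by (rule M_prime)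
  moreover have "x \<notin> M" using val_unit_iff[of x] \<open>v x = Fin 0\<close> by blast
  ultimately have "2 \<in> M" by blast
  moreover have "(2 :: 'k ambient_field) = of_const 2"
    using of_const_hom(1)[of "1 :: 'k" 1] unfolding of_const_hom(4) one_add_one by (rule sym)
  ultimately have "of_const (2 :: 'k) = 0" using constant_M[of 2] by simp
  then have "(2 :: 'k) = 0" by (simp add: of_const_eq_0_iff)
  then have "CHAR('k) dvd 2" using of_nat_eq_0_iff_char_dvd[of 2, where 'a = 'k] by simp
  then have "CHAR('k) = 1 \<or> CHAR('k) = 2" using two_is_prime_nat unfolding prime_nat_iff by blast
  then have "CHAR('k) = 1" using char by simp
  then show False using CHAR_not_1 by simp
qed

end

section \<open>The ramified extension\<close>

theorem mainTheorem1:
  fixes v :: "'k::field poly poly fract alg_closure \<Rightarrow> (rat \<times> rat) extended"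
    and K L1 L2 L :: "'k poly poly fract alg_closure set"
    and sqrtX sqrtY :: "'k poly poly fract alg_closure"
  assumes "CHAR('k) \<noteq> 2"
    and "valuation_on UNIV v"
    and "extends_lex_val v"
    and "is_henselization rational_functions v K"
    and "sqrtX ^ 2 = to_ac (Fract poly_X 1)"
    and "sqrtY ^ 2 = to_ac (Fract poly_Y 1)"
    and "L1 = generate_field \<Omega> (insert sqrtX K)"
    and "L2 = generate_field \<Omega> (insert sqrtY K)"
    and "L = generate_field \<Omega> (L1 \<union> L2)"
  shows "ramified v L2 L"
proof -
  interpret lex_valuation v by unfold_locales (fact assms)+
  have FK: "rational_functions \<subseteq> K" and K: "henselian K v"
    using assms(4) by (auto simp: is_henselization_def)
  have KL2: "K \<subseteq> L2" unfolding assms(8) by (auto intro: generate_field.incl)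
  have L2L: "L2 \<subseteq> L" unfolding assms(9) by (auto intro: generate_field.incl)
  have sqrtX_L: "sqrtX \<in> L" unfolding assms(9,7) by (auto intro!: generate_field.incl)
  have henselian: "henselian E v" if "subfield E \<Omega>" "K \<subseteq> E" for E
  proof -
    have "rational_functions \<subseteq> E" using FK that(2) by (rule order.trans)
    then show ?thesis
      by (intro henselian_algebraic_extension[OF K alg_closure_in_ambient_UNIV[OF FK] that] assms(2)
          alg_closure_in_ambient_UNIV)
  qed
  have "henselian L2 v"
    unfolding assms(8) by (rule henselian[OF subfield_generate]) (use KL2 assms(8) in simp)
  moreover have "henselian L v"
    unfolding assms(9) by (rule henselian[OF subfield_generate]) (use KL2 L2L assms(9) in blast)
  ultimately have "henselian_extension v L2 L" using L2L by (simp add: henselian_extension_def)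
  moreover have "value_group v L \<noteq> value_group v L2"
  proof -
    have s: "sqrtX ^ 2 = genX" and t: "sqrtY ^ 2 = genY" using assms(5,6) by (simp_all add: of_poly_def)
    have val: "v sqrtX = Fin (1 / 2, 0)" using val_sqrt[of sqrtX 1 0] s val_X by simp
    then have "(1 / 2, 0) \<in> value_group v L" using sqrtX_L by (auto simp: value_group_def)
    moreover have "(1 / 2, 0) \<notin> value_group v L2"
      using value_not_attained[OF assms(1,4) s t] val by (auto simp: value_group_def assms(8))
    ultimately show ?thesis by blast
  qed
  ultimately show ?thesis by (simp add: ramified_def unramified_def)
qed

end
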